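(* Let $\sigma,\nu>0$. The bicomplex Segal--Bargmann transform $$\mathcal{B}^{\sigma,\nu}_{\mathbb{T}}(\varphi)(Z)=\left(\frac{\sigma}{\pi}\right)^{1/2}\int_{\mathbb{R}}e^{-\sigma\left(x-\sqrt{\frac{\nu}{4\sigma}}\,Z\right)^2}\varphi(x)\,dx,\qquad Z\in\mathbb{T},$$ realizes a unitary integral transform mapping isometrically the bicomplex Hilbert space $L^{2,\sigma}_{\mathbb{T}}(\mathbb{R})$ onto the bicomplex Bargmann space $\mathcal{F}^{2,\nu}(\mathbb{T})$.
   Context: Bicomplex numbers: $\mathbb{T}=\{Z=z_1+jz_2:\ z_1,z_2\in\mathbb{C}\}$ is the commutative algebra in which $i^2=j^2=-1$, $ij=ji$ and $\mathbb{C}=\mathbb{R}+i\mathbb{R}$. Put $e_\pm=\frac{1\pm ij}{2}$; then $e_\pm^2=e_\pm$, $e_+e_-=0$, $e_++e_-=1$. Every $Z=z_1+jz_2$ is uniquely $Z=\alpha e_++\beta e_-$ with $\alpha=z_1-iz_2$, $\beta=z_1+iz_2\in\mathbb{C}$; algebraic operations are componentwise in $(\alpha,\beta)$, and $e^Z=e^\alpha e_++e^\beta e_-$. Set $Z^*=\overline{\alpha}e_++\overline{\beta}e_-$ and $|Z|^2=|z_1|^2+|z_2|^2=\frac{|\alpha|^2+|\beta|^2}{2}$. $\lambda$ is Lebesgue measure on $\mathbb{T}\equiv\mathbb{R}^4$ (real coordinates of $z_1,z_2$). For a $\mathbb{T}$-valued inner product, writing $\langle f,f\rangle=a\,e_++b\,e_-$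 with $a,b\ge0$, the induced norm is $\|f\|^2=\frac{a+b}{2}$. $L^{2,\sigma}_{\mathbb{T}}(\mathbb{R})$ is the space of (classes of) functions $\varphi=\varphi^+e_++\varphi^-e_-:\mathbb{R}\to\mathbb{T}$ with $\varphi^\pm:\mathbb{R}\to\mathbb{C}$ square integrable for $e^{-\sigma x^2}dx$, with inner product $\langle\varphi,\psi\rangle=\left(\frac{\sigma}{\pi}\right)^{1/2}\int_{\mathbb{R}}\varphi(x)\psi(x)^*e^{-\sigma x^2}dx$ and its induced norm. $\mathcal{H}^{2,\nu}(\mathbb{T})$ is the space of Borel measurable $f:\mathbb{T}\to\mathbb{T}$ (modulo a.e. equality) of finite induced norm for $\langle f,g\rangle=\left(\frac{\nu}{\pi}\right)^2\int_{\mathbb{T}} f(Z)g(Z)^*e^{-\nu|Z|^2}d\lambda(Z)$. A function $f:\mathbb{T}\to\mathbb{T}$ is bicomplex holomorphic if for every $Z_0\in\mathbb{T}$ the limit of $\frac{f(Z_0+H)-f(Z_0)}{H}$ as $H\to0$, $H\notin\mathcal{NC}$, exists and is finite, where $\mathcal{NC}=\{\alpha e_++\beta e_-:\alpha\beta=0\}$. $\mathcal{F}^{2,\nu}(\mathbb{T})$ is the set of bicomplex holomorphic functions on $\mathbb{T}$ belonging to $\mathcal{H}^{2,\nu}(\mathbb{T})$, with the inner product and norm of $\mathcal{H}^{2,\nu}(\mathbb{T})$. *)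

theory Defs
  imports "HOL-Analysis.Analysis"
begin

section \<open>Bicomplex numbers\<close>

text \<open>\<open>Bicomplex z\<^sub>1 z\<^sub>2\<close> stands for \<open>z\<^sub>1 + j z\<^sub>2\<close>.\<close>

datatype bicomplex = Bicomplex (bc_fst: complex) (bc_snd: complex)

lemma bicomplex_eq_iff: "Z = W \<longleftrightarrow> bc_fst Z = bc_fst W \<and> bc_snd Z = bc_snd W"
  by (cases Z; cases W) simp

instantiation bicomplex :: comm_ring_1
begin

definition "0 = Bicomplex 0 0"
definition "1 = Bicomplex 1 0"
definition "Z + W = Bicomplex (bc_fst Z + bc_fst W) (bc_snd Z + bc_snd W)"
definition "- Z = Bicomplex (- bc_fst Z) (- bc_snd Z)"
definition "Z - W = Bicomplex (bc_fst Z - bc_fst W) (bc_snd Z - bc_snd W)"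
definition "Z * W = Bicomplex (bc_fst Z * bc_fst W - bc_snd Z * bc_snd W)
                              (bc_fst Z * bc_snd W + bc_snd Z * bc_fst W)"

instance
  by standard
    (auto simp: zero_bicomplex_def one_bicomplex_def plus_bicomplex_def uminus_bicomplex_def
      minus_bicomplex_def times_bicomplex_def algebra_simps)

end

lemmas bicomplex_ring_defs =
  zero_bicomplex_def one_bicomplex_def plus_bicomplex_def uminus_bicomplex_def
  minus_bicomplex_def times_bicomplex_def

instantiation bicomplex :: real_algebra_1
begin

definition "r *\<^sub>R Z = Bicomplex (r *\<^sub>R bc_fst Z) (r *\<^sub>R bc_snd Z)"

instance
proof
  fix r s :: real and x y :: bicomplex
  show "r *\<^sub>R (x + y) = r *\<^sub>R x + r *\<^sub>R y" "(r + s) *\<^sub>R x = r *\<^sub>R x + s *\<^sub>R x"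
    "r *\<^sub>R s *\<^sub>R x = (r * s) *\<^sub>R x" "1 *\<^sub>R x = x"
    "(r *\<^sub>R x) * y = r *\<^sub>R (x * y)" "x * (r *\<^sub>R y) = r *\<^sub>R (x * y)"
    by (simp_all add: scaleR_bicomplex_def bicomplex_ring_defs algebra_simps)
qed

end

text \<open>
  The norm is the Euclidean one. It is not submultiplicative, so the type is not made an
  instance of \<open>real_normed_algebra\<close>.
\<close>

instantiation bicomplex :: real_inner
begin

definition "inner Z W = inner (bc_fst Z) (bc_fst W) + inner (bc_snd Z) (bc_snd W)"

definition norm_bicomplex_def:
  "norm Z = sqrt ((cmod (bc_fst Z))\<^sup>2 + (cmod (bc_snd Z))\<^sup>2)"

definition "sgn Z = Z /\<^sub>R norm (Z :: bicomplex)"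

definition "dist Z W = norm (Z - W :: bicomplex)"

definition uniformity_bicomplex_def [code del]:
  "(uniformity :: (bicomplex \<times> bicomplex) filter)
    = (INF e\<in>{0 <..}. principal {(x, y). dist x y < e})"

definition open_bicomplex_def [code del]:
  "open (U :: bicomplex set) \<longleftrightarrow>
    (\<forall>x\<in>U. eventually (\<lambda>(x', y). x' = x \<longrightarrow> y \<in> U) uniformity)"

instance
proof
  fix r :: real and x y z :: bicomplex
  show "inner x y = inner y x"
    by (simp add: inner_bicomplex_def inner_commute)
  show "inner (x + y) z = inner x z + inner y z"
    by (simp add: inner_bicomplex_def plus_bicomplex_def inner_add_left)
  show "inner (r *\<^sub>R x) y = r * inner x y"
    by (simp add: inner_bicomplex_def scaleR_bicomplex_def algebra_simps)
  show "0 \<le> inner x x"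
    by (simp add: inner_bicomplex_def)
  show "inner x x = 0 \<longleftrightarrow> x = 0"
    by (simp add: inner_bicomplex_def zero_bicomplex_def bicomplex_eq_iff add_nonneg_eq_0_iff)
  show "norm x = sqrt (inner x x)"
    by (simp add: inner_bicomplex_def norm_bicomplex_def power2_norm_eq_inner)
qed (rule sgn_bicomplex_def dist_bicomplex_def uniformity_bicomplex_def open_bicomplex_def)+

end

definition bc_i :: bicomplex where "bc_i = Bicomplex \<i> 0"

definition bc_j :: bicomplex where "bc_j = Bicomplex 0 1"

lemma bc_units: "bc_i * bc_i = -1" "bc_j * bc_j = -1"
  by (simp_all add: bc_i_def bc_j_def bicomplex_ring_defs)

text \<open>With this basis, \<^const>\<open>lborel\<close> is Lebesgue measure in the real coordinates of
  \<open>z\<^sub>1\<close> and \<open>z\<^sub>2\<close>.\<close>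

instantiation bicomplex :: euclidean_space
begin

definition "Basis = {1, bc_i, bc_j, bc_i * bc_j}"

instance
proof
  have B: "(Basis :: bicomplex set) = {Bicomplex 1 0, Bicomplex \<i> 0, Bicomplex 0 1, Bicomplex 0 \<i>}"
    by (simp add: Basis_bicomplex_def bc_i_def bc_j_def one_bicomplex_def times_bicomplex_def)
  show "(Basis :: bicomplex set) \<noteq> {}" "finite (Basis :: bicomplex set)"
    by (simp_all add: B)
  show "inner u v = (if u = v then 1 else 0)" if "u \<in> Basis" "v \<in> Basis" for u v :: bicomplex
    using that unfolding B
    by (elim insertE; simp add: inner_bicomplex_def complex_eq_iff)
  show "(\<forall>u\<in>Basis. inner x u = 0) \<longleftrightarrow> x = 0" for x :: bicomplex
    unfolding B
    by (simp add: inner_bicomplex_def zero_bicomplex_def bicomplex_eq_iff complex_eq_iff)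
qed

end

subsection \<open>Idempotent representation\<close>

definition bc_of_complex :: "complex \<Rightarrow> bicomplex" where
  "bc_of_complex z = Bicomplex z 0"

definition bc_eplus :: bicomplex where "bc_eplus = (1/2) *\<^sub>R (1 + bc_i * bc_j)"

definition bc_eminus :: bicomplex where "bc_eminus = (1/2) *\<^sub>R (1 - bc_i * bc_j)"

definition bc_idem :: "complex \<Rightarrow> complex \<Rightarrow> bicomplex" where
  "bc_idem \<alpha> \<beta> = bc_of_complex \<alpha> * bc_eplus + bc_of_complex \<beta> * bc_eminus"

definition bc_alpha :: "bicomplex \<Rightarrow> complex" where
  "bc_alpha Z = bc_fst Z - \<i> * bc_snd Z"

definition bc_beta :: "bicomplex \<Rightarrow> complex" where
  "bc_beta Z = bc_fst Z + \<i> * bc_snd Z"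

lemmas bc_defs = bicomplex_ring_defs scaleR_bicomplex_def bc_of_complex_def bc_i_def bc_j_def
  bc_eplus_def bc_eminus_def bc_idem_def bc_alpha_def bc_beta_def

lemma bc_idempotents:
  "bc_eplus * bc_eplus = bc_eplus" "bc_eminus * bc_eminus = bc_eminus"
  "bc_eplus * bc_eminus = 0" "bc_eplus + bc_eminus = 1"
  by (simp_all add: bc_defs complex_eq_iff)

lemma bc_alpha_idem [simp]: "bc_alpha (bc_idem \<alpha> \<beta>) = \<alpha>"
  and bc_beta_idem [simp]: "bc_beta (bc_idem \<alpha> \<beta>) = \<beta>"
  by (simp_all add: bc_defs complex_eq_iff)

lemma bc_idem_alpha_beta [simp]: "bc_idem (bc_alpha Z) (bc_beta Z) = Z"
  by (simp add: bc_defs bicomplex_eq_iff complex_eq_iff field_simps)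

lemma bc_idem_mult: "bc_idem a b * bc_idem c d = bc_idem (a * c) (b * d)"
proof -
  have "bc_idem a b * bc_idem c d =
      bc_of_complex a * bc_of_complex c * (bc_eplus * bc_eplus) +
      bc_of_complex b * bc_of_complex d * (bc_eminus * bc_eminus) +
      (bc_of_complex a * bc_of_complex d + bc_of_complex b * bc_of_complex c) * (bc_eplus * bc_eminus)"
    unfolding bc_idem_def by (simp add: algebra_simps)
  moreover have "bc_of_complex x * bc_of_complex y = bc_of_complex (x * y)" for x y
    by (simp add: bc_of_complex_def times_bicomplex_def)
  ultimately show ?thesis
    by (simp only: bc_idempotents bc_idem_def mult_zero_right add_0_right)
qed

lemma norm_bicomplex_idem: "(norm Z)\<^sup>2 = ((cmod (bc_alpha Z))\<^sup>2 + (cmod (bc_beta Z))\<^sup>2) / 2"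
  by (simp add: norm_bicomplex_def bc_alpha_def bc_beta_def cmod_power2)
     (simp add: power2_eq_square algebra_simps)

definition bc_star :: "bicomplex \<Rightarrow> bicomplex" where
  "bc_star Z = bc_idem (cnj (bc_alpha Z)) (cnj (bc_beta Z))"

definition bc_exp :: "bicomplex \<Rightarrow> bicomplex" where
  "bc_exp Z = bc_idem (exp (bc_alpha Z)) (exp (bc_beta Z))"

definition null_cone :: "bicomplex set" where
  "null_cone = {bc_idem \<alpha> \<beta> |\<alpha> \<beta>. \<alpha> * \<beta> = 0}"

text \<open>Division is a genuine division only off the null cone.\<close>

instantiation bicomplex :: inverse
begin

definition inverse_bicomplex :: "bicomplex \<Rightarrow> bicomplex" where
  "inverse Z = bc_idem (inverse (bc_alpha Z)) (inverse (bc_beta Z))"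

definition "Z div W = Z * inverse (W :: bicomplex)"

instance ..

end

lemma bc_right_inverse:
  assumes "Z \<notin> null_cone"
  shows "Z * inverse Z = 1"
proof -
  have "bc_alpha Z * bc_beta Z \<noteq> 0"
    using assms bc_idem_alpha_beta[of Z, symmetric] unfolding null_cone_def by blast
  then have "bc_idem (bc_alpha Z) (bc_beta Z) * inverse Z = bc_idem 1 1"
    unfolding inverse_bicomplex_def bc_idem_mult by (simp del: bc_idem_alpha_beta)
  also have "bc_idem 1 1 = 1"
    by (simp add: bc_idem_def bc_of_complex_def bc_idempotents flip: one_bicomplex_def)
  finally show ?thesis
    by (simp only: bc_idem_alpha_beta)
qed

definition bc_holomorphic :: "(bicomplex \<Rightarrow> bicomplex) \<Rightarrow> bool" where
  "bc_holomorphic f \<longleftrightarrow>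
    (\<forall>Z\<^sub>0. \<exists>L. ((\<lambda>H. (f (Z\<^sub>0 + H) - f Z\<^sub>0) / H) \<longlongrightarrow> L) (at 0 within - null_cone))"

section \<open>Function spaces\<close>

text \<open>
  The spaces consist of representatives; their elements are to be identified when they agree
  almost everywhere.
\<close>

text \<open>The norm of \<open>f\<close> is obtained from the bicomplex number \<open>W = \<langle>f,f\<rangle>\<close>.\<close>

definition bc_induced_norm :: "bicomplex \<Rightarrow> real" where
  "bc_induced_norm W = sqrt ((Re (bc_alpha W) + Re (bc_beta W)) / 2)"

definition L2_inner ::
  "real \<Rightarrow> (real \<Rightarrow> bicomplex) \<Rightarrow> (real \<Rightarrow> bicomplex) \<Rightarrow> bicomplex" where
  "L2_inner \<sigma> \<phi> \<psi> =
    sqrt (\<sigma> / pi) *\<^sub>R (LINT x|lborel. exp (- \<sigma> * x\<^sup>2) *\<^sub>R (\<phi> x * bc_star (\<psi> x)))"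

definition L2_norm :: "real \<Rightarrow> (real \<Rightarrow> bicomplex) \<Rightarrow> real" where
  "L2_norm \<sigma> \<phi> = bc_induced_norm (L2_inner \<sigma> \<phi> \<phi>)"

definition L2_space :: "real \<Rightarrow> (real \<Rightarrow> bicomplex) set" where
  "L2_space \<sigma> = {\<phi>.
      (\<lambda>x. bc_alpha (\<phi> x)) \<in> borel_measurable lborel \<and>
      (\<lambda>x. bc_beta (\<phi> x)) \<in> borel_measurable lborel \<and>
      integrable lborel (\<lambda>x. (cmod (bc_alpha (\<phi> x)))\<^sup>2 * exp (- \<sigma> * x\<^sup>2)) \<and>
      integrable lborel (\<lambda>x. (cmod (bc_beta (\<phi> x)))\<^sup>2 * exp (- \<sigma> * x\<^sup>2))}"

definition H2_inner ::
  "real \<Rightarrow> (bicomplex \<Rightarrow> bicomplex) \<Rightarrow> (bicomplex \<Rightarrow> bicomplex) \<Rightarrow> bicomplex" where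
  "H2_inner \<nu> f g =
    (\<nu> / pi)\<^sup>2 *\<^sub>R (LINT Z|lborel. exp (- \<nu> * (norm Z)\<^sup>2) *\<^sub>R (f Z * bc_star (g Z)))"

definition H2_norm :: "real \<Rightarrow> (bicomplex \<Rightarrow> bicomplex) \<Rightarrow> real" where
  "H2_norm \<nu> f = bc_induced_norm (H2_inner \<nu> f f)"

text \<open>
  The components of the integrand of \<open>\<langle>f,f\<rangle>\<close> are nonnegative, so a finite norm means that
  this integrand is integrable. (The Bochner integral of a non-integrable function is \<open>0\<close>,
  so finiteness cannot be read off from \<^const>\<open>H2_norm\<close>.)
\<close>

definition H2_space :: "real \<Rightarrow> (bicomplex \<Rightarrow> bicomplex) set" where
  "H2_space \<nu> = {f. f \<in> borel_measurable borel \<and>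
      integrable lborel (\<lambda>Z. exp (- \<nu> * (norm Z)\<^sup>2) *\<^sub>R (f Z * bc_star (f Z)))}"

definition bargmann_space :: "real \<Rightarrow> (bicomplex \<Rightarrow> bicomplex) set" where
  "bargmann_space \<nu> = {f \<in> H2_space \<nu>. bc_holomorphic f}"

section \<open>The Segal--Bargmann transform\<close>

definition sb_kernel :: "real \<Rightarrow> real \<Rightarrow> bicomplex \<Rightarrow> real \<Rightarrow> bicomplex" where
  "sb_kernel \<sigma> \<nu> Z x = bc_exp (- (\<sigma> *\<^sub>R (of_real x - sqrt (\<nu> / (4 * \<sigma>)) *\<^sub>R Z)\<^sup>2))"

definition sb_transform ::
  "real \<Rightarrow> real \<Rightarrow> (real \<Rightarrow> bicomplex) \<Rightarrow> bicomplex \<Rightarrow> bicomplex" where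
  "sb_transform \<sigma> \<nu> \<phi> Z = sqrt (\<sigma> / pi) *\<^sub>R (LINT x|lborel. sb_kernel \<sigma> \<nu> Z x * \<phi> x)"

end

theory Submission
  imports Defs "HOL-Probability.Probability" "HOL-Complex_Analysis.Complex_Analysis"
begin

text \<open>
  In the idempotent coordinates \<open>\<alpha> = z\<^sub>1 - i z\<^sub>2\<close>, \<open>\<beta> = z\<^sub>1 + i z\<^sub>2\<close> every ingredient of the theorem splits.
  The kernel, the product and the involution are componentwise. A bicomplex holomorphic function is a pair
  of entire functions, one of \<open>\<alpha>\<close> alone and one of \<open>\<beta>\<close> alone (\<open>bc_holomorphic_iff\<close>): increments of \<open>\<alpha>\<close> much
  smaller than those of \<open>\<beta>\<close> have to obey the same difference quotient bound. Finally, \<open>\<alpha>\<close> and \<open>\<beta>\<close>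
  each carry the Gaussian probability measure of parameter \<open>\<nu>\<close> on the bicomplex numbers to the Gaussian
  measure of parameter \<open>\<nu>/2\<close> on the complex plane (\<open>distr_gauss_bicomplex\<close>). So the theorem follows
  from the statement about one complex variable, that
  \<open>T \<phi> z = \<integral> exp (s x z - \<nu> z\<^sup>2 / 4) \<phi> x dx\<close>, with \<open>s = sqrt (\<sigma> \<nu>)\<close> and the integral taken for the
  Gaussian measure of parameter \<open>\<sigma>\<close>, is unitary from \<open>L\<^sup>2\<close> onto the entire functions that are square
  integrable for the Gaussian measure of parameter \<open>\<nu>/2\<close>.

  That statement is one of matching orthogonal systems. The kernel is a generating function
  \<open>\<Sum> h\<^sub>n(x) z\<^sup>n\<close>, where the \<open>h\<^sub>n\<close> are rescaled Hermite polynomials. The Gaussian integral of a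
  product of two kernels is \<open>exp (\<nu> a b / 2)\<close>, and comparing coefficients shows that the \<open>h\<^sub>n\<close> are
  orthogonal with \<open>\<parallel>h\<^sub>n\<parallel>\<^sup>2 = (\<nu>/2)\<^sup>n / n!\<close> (\<open>gauss_poly_orthogonal\<close>). On the other side the monomials are
  orthogonal with \<open>\<parallel>z\<^sup>n\<parallel>\<^sup>2 = n! / (\<nu>/2)\<^sup>n\<close>, already on every disc centred at \<open>0\<close>, by rotation invariance;
  so an entire function with Taylor coefficients \<open>a\<^sub>n\<close> satisfies
  \<open>\<parallel>F\<parallel>\<^sup>2 = \<Sum> |a\<^sub>n|\<^sup>2 n! / (\<nu>/2)\<^sup>n\<close>, both sides being possibly infinite (\<open>nn_integral_gauss_entire\<close>).
  The Taylor coefficients of \<open>T \<phi>\<close> are the inner products of \<open>\<phi>\<close> with the \<open>h\<^sub>n\<close>, so \<open>T\<close> is isometric as soon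
  as the \<open>h\<^sub>n\<close> satisfy Parseval's identity. This is the completeness of the Hermite polynomials: a
  function orthogonal to all of them has \<open>T \<phi> = 0\<close>, and on the imaginary axis \<open>T \<phi>\<close> is, up to
  nonzero factors, the Fourier transform of \<open>\<phi>\<close> times a Gaussian, which determines \<open>\<phi>\<close>
  (\<open>AE_zero_if_fourier_zero\<close>). Surjectivity is the Riesz--Fischer theorem
  (\<open>riesz_fischer\<close>): the Taylor coefficients of a given entire function of finite norm are, suitably
  weighted, the coefficients of some \<open>\<phi>\<close> in \<open>L\<^sup>2\<close>.
\<close>

section \<open>Lebesgue measure on the complex and the bicomplex numbers\<close>

text \<open>
  Lebesgue measure is characterized by its values on coordinate boxes, so identifying two Euclidean
  spaces by matching their standard bases preserves it. This gives access to Fubini's theorem for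
  \<^typ>\<open>complex\<close> and \<^typ>\<open>bicomplex\<close>.
\<close>

lemma distr_lborel_basis_bij:
  fixes f :: "'a::euclidean_space \<Rightarrow> 'b::euclidean_space"
  assumes lin: "linear f" and bij: "bij_betw f Basis Basis"
  shows "distr lborel borel f = lborel"
proof (rule sym, rule lborel_eqI)
  have meas: "f \<in> borel_measurable borel"
    using lin by (intro borel_measurable_continuous_onI linear_continuous_on) (simp add: linear_conv_bounded_linear)
  have inner: "f x \<bullet> f b = x \<bullet> b" if b: "b \<in> Basis" for x b
  proof -
    have "f x = f (\<Sum>c\<in>Basis. (x \<bullet> c) *\<^sub>R c)"
      by (simp add: euclidean_representation)
    also have "\<dots> = (\<Sum>c\<in>Basis. (x \<bullet> c) *\<^sub>R f c)"
      using lin by (simp add: linear_sum linear_cmul)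
    finally have "f x \<bullet> f b = (\<Sum>c\<in>Basis. (x \<bullet> c) * (f c \<bullet> f b))"
      by (simp add: inner_sum_left)
    also have "\<dots> = (\<Sum>c\<in>Basis. if c = b then x \<bullet> c else 0)"
    proof (intro sum.cong refl)
      fix c :: 'a assume c: "c \<in> Basis"
      have "f c \<in> Basis" "f b \<in> Basis" "f c = f b \<longleftrightarrow> c = b"
        using bij b c by (auto simp: bij_betw_def inj_on_def)
      then show "(x \<bullet> c) * (f c \<bullet> f b) = (if c = b then x \<bullet> c else 0)"
        by (simp add: inner_Basis)
    qed
    finally show ?thesis using b by simp
  qed
  have img: "f ` Basis = Basis" and inj: "inj_on f Basis"
    using bij by (auto simp: bij_betw_def)
  fix l u :: 'b
  assume lu: "\<And>b. b \<in> Basis \<Longrightarrow> l \<bullet> b \<le> u \<bullet> b"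
  \<comment> \<open>the adjoint of \<open>f\<close>, which carries the corners of a box back\<close>
  define pull where "pull w = (\<Sum>b\<in>Basis. (w \<bullet> f b) *\<^sub>R b)" for w
  have pull: "pull w \<bullet> b = w \<bullet> f b" if "b \<in> Basis" for w b
    using that by (simp add: pull_def)
  have "f -` box l u = box (pull l) (pull u)"
    unfolding box_def img[symmetric] by (auto simp: inner pull)
  then have "emeasure (distr lborel borel f) (box l u) = emeasure lborel (box (pull l) (pull u))"
    using meas by (subst emeasure_distr) auto
  also have "\<dots> = (\<Prod>b\<in>Basis. (pull u - pull l) \<bullet> b)"
  proof (rule emeasure_lborel_box)
    fix b :: 'a assume "b \<in> Basis"
    then show "pull l \<bullet> b \<le> pull u \<bullet> b"
      using lu[of "f b"] img by (auto simp: pull)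
  qed
  also have "(\<Prod>b\<in>Basis. (pull u - pull l) \<bullet> b) = (\<Prod>b\<in>Basis. (u - l) \<bullet> f b)"
    by (intro prod.cong) (auto simp: inner_diff_left pull)
  also have "\<dots> = (\<Prod>b\<in>Basis. (u - l) \<bullet> b)"
    by (rule prod.reindex_bij_betw[OF bij])
  finally show "emeasure (distr lborel borel f) (box l u) = (\<Prod>b\<in>Basis. (u - l) \<bullet> b)" .
qed simp

lemma distr_lborel_Complex: "distr lborel borel (\<lambda>(a, b). Complex a b) = lborel"
proof (rule distr_lborel_basis_bij)
  show "linear (\<lambda>(a, b). Complex a b)"
    by (rule linearI) (auto simp: complex_eq_iff)
  show "bij_betw (\<lambda>(a, b). Complex a b) Basis Basis"
    by (auto simp: bij_betw_def inj_on_def Basis_prod_def Basis_complex_def complex_eq_iff)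
qed

lemma distr_lborel_Bicomplex: "distr lborel borel (\<lambda>(z, w). Bicomplex z w) = lborel"
proof (rule distr_lborel_basis_bij)
  show "linear (\<lambda>(a, b). Bicomplex a b)"
    by (rule linearI) (auto simp: plus_bicomplex_def scaleR_bicomplex_def)
  show "bij_betw (\<lambda>(a, b). Bicomplex a b) Basis Basis"
    unfolding bij_betw_def
    by (auto simp: inj_on_def Basis_prod_def Basis_complex_def Basis_bicomplex_def bc_defs complex_eq_iff)
qed

lemma borel_measurable_Complex [measurable (raw)]:
  assumes "f \<in> borel_measurable M" "g \<in> borel_measurable M"
  shows "(\<lambda>x. Complex (f x) (g x)) \<in> borel_measurable M"
  using assms unfolding Complex_eq by measurable

lemma borel_measurable_Bicomplex [measurable (raw)]:
  assumes "f \<in> borel_measurable M" "g \<in> borel_measurable M"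
  shows "(\<lambda>x. Bicomplex (f x) (g x)) \<in> borel_measurable M"
proof -
  have "continuous_on UNIV (\<lambda>(a, b). Bicomplex a b)"
    by (rule linear_continuous_on, subst linear_conv_bounded_linear[symmetric], rule linearI)
       (auto simp: plus_bicomplex_def scaleR_bicomplex_def)
  then have "(\<lambda>(a, b). Bicomplex a b) \<in> borel_measurable borel"
    by (rule borel_measurable_continuous_onI)
  from measurable_compose[OF borel_measurable_Pair[OF assms] this] show ?thesis
    by simp
qed

lemma borel_measurable_split_Complex [measurable]: "(\<lambda>(a, b). Complex a b) \<in> borel_measurable borel"
  and borel_measurable_split_Bicomplex [measurable]: "(\<lambda>(z, w). Bicomplex z w) \<in> borel_measurable borel"
  unfolding borel_prod[symmetric] by measurable

lemma nn_integral_lborel_complex: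
  assumes [measurable]: "g \<in> borel_measurable borel"
  shows "(\<integral>\<^sup>+z. g z \<partial>lborel) = (\<integral>\<^sup>+b. \<integral>\<^sup>+a. g (Complex a b) \<partial>lborel \<partial>lborel)"
proof -
  have "(\<integral>\<^sup>+z. g z \<partial>lborel) = (\<integral>\<^sup>+p. g (case p of (a, b) \<Rightarrow> Complex a b) \<partial>lborel)"
    by (subst distr_lborel_Complex[symmetric], subst nn_integral_distr) auto
  also have "\<dots> = (\<integral>\<^sup>+b. \<integral>\<^sup>+a. g (Complex a b) \<partial>lborel \<partial>lborel)"
    unfolding lborel_prod[symmetric]
    by (subst lborel_pair.nn_integral_snd[symmetric]) (auto simp: lborel_prod borel_prod[symmetric])
  finally show ?thesis .
qed

lemma nn_integral_lborel_bicomplex: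
  assumes [measurable]: "g \<in> borel_measurable borel"
  shows "(\<integral>\<^sup>+Z. g Z \<partial>lborel) = (\<integral>\<^sup>+z. \<integral>\<^sup>+w. g (Bicomplex z w) \<partial>lborel \<partial>lborel)"
proof -
  have "(\<integral>\<^sup>+z. g z \<partial>lborel) = (\<integral>\<^sup>+p. g (case p of (a, b) \<Rightarrow> Bicomplex a b) \<partial>lborel)"
    by (subst distr_lborel_Bicomplex[symmetric], subst nn_integral_distr) auto
  also have "\<dots> = (\<integral>\<^sup>+z. \<integral>\<^sup>+w. g (Bicomplex z w) \<partial>lborel \<partial>lborel)"
    unfolding lborel_prod[symmetric]
    by (subst lborel.nn_integral_fst[symmetric]) (auto simp: lborel_prod borel_prod[symmetric])
  finally show ?thesis .
qed

lemma nn_integral_lborel_translate: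
  fixes c :: "'a::euclidean_space"
  assumes [measurable]: "g \<in> borel_measurable borel"
  shows "(\<integral>\<^sup>+x. g (c + x) \<partial>lborel) = (\<integral>\<^sup>+x. g x \<partial>lborel)"
  by (subst (2) lborel_distr_plus[of c, symmetric], subst nn_integral_distr) auto

lemma nn_integral_lborel_shear_Re:
  fixes t :: real
  assumes [measurable]: "g \<in> borel_measurable borel"
  shows "(\<integral>\<^sup>+z. g (z + of_real (t * Im z)) \<partial>lborel) = (\<integral>\<^sup>+z. g z \<partial>lborel)"
proof -
  have "(\<integral>\<^sup>+a. g (Complex a b + of_real (t * b)) \<partial>lborel) = (\<integral>\<^sup>+a. g (Complex a b) \<partial>lborel)" for b
  proof -
    have "Complex a b + of_real (t * b) = Complex (t * b + a) b" for a
      by (simp add: complex_eq_iff)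
    then show ?thesis
      using nn_integral_lborel_translate[of "\<lambda>a. g (Complex a b)" "t * b"] by (simp del: of_real_mult)
  qed
  then show ?thesis
    by (simp add: nn_integral_lborel_complex)
qed

lemma nn_integral_lborel_complex':
  assumes [measurable]: "g \<in> borel_measurable borel"
  shows "(\<integral>\<^sup>+z. g z \<partial>lborel) = (\<integral>\<^sup>+a. \<integral>\<^sup>+b. g (Complex a b) \<partial>lborel \<partial>lborel)"
  by (subst nn_integral_lborel_complex, simp, rule lborel_pair.Fubini') measurable

lemma nn_integral_lborel_shear_Im:
  fixes t :: real
  assumes [measurable]: "g \<in> borel_measurable borel"
  shows "(\<integral>\<^sup>+z. g (z + \<i> * of_real (t * Re z)) \<partial>lborel) = (\<integral>\<^sup>+z. g z \<partial>lborel)"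
proof -
  have "(\<integral>\<^sup>+b. g (Complex a b + \<i> * of_real (t * a)) \<partial>lborel) = (\<integral>\<^sup>+b. g (Complex a b) \<partial>lborel)" for a
  proof -
    have "Complex a b + \<i> * of_real (t * a) = Complex a (t * a + b)" for b
      by (simp add: complex_eq_iff)
    then show ?thesis
      using nn_integral_lborel_translate[of "\<lambda>b. g (Complex a b)" "t * a"] by (simp del: of_real_mult)
  qed
  then show ?thesis
    by (simp add: nn_integral_lborel_complex')
qed

text \<open>
  A rotation that is not a multiple of a half turn is a product of three shears, two along the real axis and one along
  the imaginary axis, and a shear only translates each line parallel to its axis.
\<close>

lemma nn_integral_lborel_rotate:
  assumes [measurable]: "g \<in> borel_measurable borel" and c: "cmod c = 1"
  shows "(\<integral>\<^sup>+z. g (c * z) \<partial>lborel) = (\<integral>\<^sup>+z. g z \<partial>lborel)"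
proof (cases "Im c = 0")
  case True
  then have "c = 1 \<or> c = -1"
    using c by (auto simp: complex_eq_iff norm_complex_def)
  moreover have "(\<integral>\<^sup>+z. g (- z) \<partial>lborel) = (\<integral>\<^sup>+z. g z \<partial>lborel)"
  proof -
    have "lborel = distr lborel borel (uminus :: complex \<Rightarrow> complex)"
      using lborel_affine[of "-1" "0::complex"] by (simp add: density_1)
    then have "(\<integral>\<^sup>+z. g z \<partial>lborel) = (\<integral>\<^sup>+z. g z \<partial>distr lborel borel uminus)"
      by simp
    then show ?thesis
      by (simp add: nn_integral_distr)
  qed
  ultimately show ?thesis by auto
next
  case False
  define u v where "u = Re c" and "v = Im c"
  \<comment> \<open>For \<open>c = cis \<theta>\<close> this is \<open>- tan (\<theta>/2)\<close>.\<close>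
  define t where "t = (u - 1) / v"
  define R where "R z = z + of_real (t * Im z)" for z
  define S where "S z = z + \<i> * of_real (v * Re z)" for z
  have [measurable]: "R \<in> borel_measurable borel" "S \<in> borel_measurable borel"
    unfolding R_def S_def by measurable
  have uv: "u\<^sup>2 + v\<^sup>2 = 1" and v: "v \<noteq> 0"
    using c False by (auto simp: u_def v_def norm_complex_def)
  have tv: "t * v = u - 1" and tu: "t * (1 + u) = - v"
    using v uv by (auto simp: t_def field_simps power2_eq_square)
  have rot: "R (S (R z)) = c * z" for z
  proof -
    have 1: "v * (Re z + t * Im z) + Im z = v * Re z + u * Im z"
      using arg_cong[OF tv, of "\<lambda>x. x * Im z"] by (simp add: algebra_simps)
    have 2: "Re z + t * Im z + t * (v * Re z + u * Im z) = u * Re z - v * Im z"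
      using arg_cong[OF tv, of "\<lambda>x. x * Re z"] arg_cong[OF tu, of "\<lambda>x. x * Im z"]
      by (simp add: algebra_simps)
    show ?thesis
      using 1 2 by (simp add: complex_eq_iff R_def S_def u_def v_def add.commute)
  qed
  have "(\<integral>\<^sup>+z. g (c * z) \<partial>lborel) = (\<integral>\<^sup>+z. (\<lambda>w. g (R (S w))) (R z) \<partial>lborel)"
    by (simp add: rot)
  also have "\<dots> = (\<integral>\<^sup>+w. g (R (S w)) \<partial>lborel)"
    using nn_integral_lborel_shear_Re[of "\<lambda>w. g (R (S w))" t] by (simp add: R_def)
  also have "\<dots> = (\<integral>\<^sup>+w. g (R w) \<partial>lborel)"
    using nn_integral_lborel_shear_Im[of "\<lambda>w. g (R w)" v] by (simp add: S_def)
  also have "\<dots> = (\<integral>\<^sup>+z. g z \<partial>lborel)"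
    unfolding R_def by (rule nn_integral_lborel_shear_Re) simp
  finally show ?thesis .
qed

section \<open>Gaussian measures\<close>

text \<open>
  The factor \<open>sqrt (t / pi) ^ DIM('a)\<close> makes this a probability measure. For the real line with
  \<open>t = \<sigma>\<close> and for the bicomplex numbers with \<open>t = \<nu>\<close> it is the weight, normalization included, in
  \<^const>\<open>L2_inner\<close> and \<^const>\<open>H2_inner\<close>.
\<close>

definition gauss :: "real \<Rightarrow> 'a::euclidean_space measure" where
  "gauss t = density lborel (\<lambda>x. ennreal (sqrt (t / pi) ^ DIM('a) * exp (- t * (norm x)\<^sup>2)))"

lemma sets_gauss [measurable_cong, simp]: "sets (gauss t) = sets borel"
  and space_gauss [simp]: "space (gauss t) = UNIV"
  by (simp_all add: gauss_def)

lemma nn_integral_gaussian_real: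
  assumes "t > 0"
  shows "(\<integral>\<^sup>+x. ennreal (exp (- t * x\<^sup>2)) \<partial>lborel) = ennreal (sqrt (pi / t))"
proof -
  define s where "s = 1 / sqrt (2 * t)"
  have s: "s > 0" and s2: "s\<^sup>2 = 1 / (2 * t)"
    using assms by (auto simp: s_def power_divide)
  have "exp (- t * x\<^sup>2) = sqrt (pi / t) * normal_density 0 s x" for x
    using assms unfolding normal_density_def s2 by (simp add: real_sqrt_divide mult.commute)
  then have "(\<integral>\<^sup>+x. ennreal (exp (- t * x\<^sup>2)) \<partial>lborel)
      = (\<integral>\<^sup>+x. ennreal (sqrt (pi / t)) * ennreal (normal_density 0 s x) \<partial>lborel)"
    using assms by (intro nn_integral_cong) (simp add: ennreal_mult)
  also have "\<dots> = ennreal (sqrt (pi / t)) * (\<integral>\<^sup>+x. ennreal (normal_density 0 s x) \<partial>lborel)"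
    by (rule nn_integral_cmult) simp
  also have "(\<integral>\<^sup>+x. ennreal (normal_density 0 s x) \<partial>lborel) = 1"
    using s by (subst nn_integral_eq_integral) auto
  finally show ?thesis by simp
qed

lemma nn_integral_gaussian_complex:
  assumes "t > 0"
  shows "(\<integral>\<^sup>+z. ennreal (exp (- t * (cmod (z - w))\<^sup>2)) \<partial>lborel) = ennreal (pi / t)"
proof -
  have "(\<integral>\<^sup>+z. ennreal (exp (- t * (cmod (z - w))\<^sup>2)) \<partial>lborel)
      = (\<integral>\<^sup>+z. ennreal (exp (- t * (cmod z)\<^sup>2)) \<partial>lborel)"
    using nn_integral_lborel_translate[of "\<lambda>z. ennreal (exp (- t * (cmod z)\<^sup>2))" "- w"]
    by (simp add: algebra_simps)
  also have "\<dots> = (\<integral>\<^sup>+b. \<integral>\<^sup>+a. ennreal (exp (- t * b\<^sup>2)) * ennreal (exp (- t * a\<^sup>2)) \<partial>lborel \<partial>lborel)"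
    by (subst nn_integral_lborel_complex)
       (auto simp: cmod_power2 ennreal_mult'[symmetric] exp_add[symmetric] algebra_simps intro!: nn_integral_cong)
  also have "\<dots> = ennreal (sqrt (pi / t)) * ennreal (sqrt (pi / t))"
    using nn_integral_gaussian_real[OF assms] by (simp add: nn_integral_cmult nn_integral_multc)
  also have "\<dots> = ennreal (pi / t)"
    using assms by (simp add: ennreal_mult'[symmetric])
  finally show ?thesis .
qed

lemma emeasure_gauss_UNIV:
  "emeasure (gauss t :: 'a::euclidean_space measure) UNIV
    = ennreal (sqrt (t / pi) ^ DIM('a)) * (\<integral>\<^sup>+x. ennreal (exp (- t * (norm (x::'a))\<^sup>2)) \<partial>lborel)"
  if "t > 0"
  using that by (simp add: gauss_def emeasure_density ennreal_mult nn_integral_cmult)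

lemma prob_space_gauss_complex: "t > 0 \<Longrightarrow> prob_space (gauss t :: complex measure)"
  using nn_integral_gaussian_complex[of t 0]
  by (intro prob_spaceI)
     (simp add: emeasure_gauss_UNIV ennreal_mult'[symmetric])

lemma borel_measurable_bc_fst_snd [measurable]:
  "bc_fst \<in> borel_measurable borel" "bc_snd \<in> borel_measurable borel"
proof -
  have "linear bc_fst" "linear bc_snd"
    by (auto intro!: linearI simp: plus_bicomplex_def scaleR_bicomplex_def)
  then show "bc_fst \<in> borel_measurable borel" "bc_snd \<in> borel_measurable borel"
    by (auto intro!: borel_measurable_continuous_onI linear_continuous_on simp: linear_conv_bounded_linear)
qed

lemma DIM_bicomplex [simp]: "DIM(bicomplex) = 4"
  by (auto simp: Basis_bicomplex_def bc_defs complex_eq_iff card_insert_if)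

text \<open>
  The idempotent coordinates are the cases \<open>c = -i\<close> and \<open>c = i\<close>. In probabilistic terms, under
  \<open>gauss \<nu>\<close> the coordinates \<open>z\<^sub>1\<close> and \<open>z\<^sub>2\<close> are independent rotation invariant Gaussians, so
  \<open>z\<^sub>1 + c z\<^sub>2\<close> is again Gaussian, with twice their variance.
\<close>

lemma distr_gauss_bicomplex:
  assumes \<nu>: "\<nu> > 0" and c: "cmod c = 1"
  shows "distr (gauss \<nu>) borel (\<lambda>Z. bc_fst Z + c * bc_snd Z) = gauss (\<nu> / 2)"
proof (rule measure_eqI)
  fix A assume "A \<in> sets (distr (gauss \<nu>) borel (\<lambda>Z. bc_fst Z + c * bc_snd Z))"
  then have A [measurable]: "A \<in> sets borel" by simp
  define K where "K = (\<nu> / pi)\<^sup>2"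
  have K: "K \<ge> 0" by (simp add: K_def)
  have "sqrt (\<nu> / pi) ^ 4 = ((sqrt (\<nu> / pi))\<^sup>2)\<^sup>2"
    by (simp flip: power_mult)
  then have K4: "sqrt (\<nu> / pi) ^ 4 = K"
    using \<nu> by (simp add: K_def)
  define G where "G z w = ennreal (K * exp (- \<nu> * ((cmod z)\<^sup>2 + (cmod w)\<^sup>2))) * indicator A (z + w)" for z w
  have [measurable]: "(\<lambda>(z, w). G z w) \<in> borel_measurable (borel \<Otimes>\<^sub>M borel)"
    unfolding G_def by measurable
  have "emeasure (distr (gauss \<nu>) borel (\<lambda>Z. bc_fst Z + c * bc_snd Z)) A
      = (\<integral>\<^sup>+Z. indicator A (bc_fst Z + c * bc_snd Z) \<partial>gauss \<nu>)"
    by (simp add: nn_integral_distr flip: nn_integral_indicator)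
  also have "\<dots> = (\<integral>\<^sup>+Z. G (bc_fst Z) (c * bc_snd Z) \<partial>lborel)"
    using \<nu> c unfolding gauss_def
    by (subst nn_integral_density)
       (auto intro!: nn_integral_cong
          simp: G_def K4 norm_bicomplex_def norm_mult)
  also have "\<dots> = (\<integral>\<^sup>+z. \<integral>\<^sup>+w. G z (c * w) \<partial>lborel \<partial>lborel)"
    by (subst nn_integral_lborel_bicomplex) auto
  also have "\<dots> = (\<integral>\<^sup>+z. \<integral>\<^sup>+w. G z w \<partial>lborel \<partial>lborel)"
    using nn_integral_lborel_rotate[OF _ c, of "G _"] by simp
  also have "\<dots> = (\<integral>\<^sup>+z. \<integral>\<^sup>+w. G z (w - z) \<partial>lborel \<partial>lborel)"
    using nn_integral_lborel_translate[of "G z" "- z" for z] by simp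
  also have "\<dots> = (\<integral>\<^sup>+w. \<integral>\<^sup>+z. G z (w - z) \<partial>lborel \<partial>lborel)"
    by (rule lborel_pair.Fubini') measurable
  also have "\<dots> = (\<integral>\<^sup>+w. ennreal (\<nu> / 2 / pi * exp (- (\<nu> / 2) * (cmod w)\<^sup>2)) * indicator A w \<partial>lborel)"
  proof (rule nn_integral_cong)
    fix w :: complex
    \<comment> \<open>completing the square in \<open>z\<close>\<close>
    have "(cmod z)\<^sup>2 + (cmod (w - z))\<^sup>2 = 2 * (cmod (z - w / 2))\<^sup>2 + (cmod w)\<^sup>2 / 2" for z
      unfolding cmod_power2 by (simp add: power2_eq_square field_simps)
    then have "G z (w - z) = ennreal (K * exp (- (\<nu> / 2) * (cmod w)\<^sup>2)) * indicator A w *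
        ennreal (exp (- (2 * \<nu>) * (cmod (z - w / 2))\<^sup>2))" for z
      using K by (simp add: G_def ennreal_mult'[symmetric] indicator_def algebra_simps flip: exp_add)
    then have "(\<integral>\<^sup>+z. G z (w - z) \<partial>lborel)
        = ennreal (K * exp (- (\<nu> / 2) * (cmod w)\<^sup>2)) * indicator A w * ennreal (pi / (2 * \<nu>))"
      using \<nu> nn_integral_gaussian_complex[of "2 * \<nu>" "w / 2"] by (simp add: nn_integral_cmult)
    also have "\<dots> = ennreal (K * (pi / (2 * \<nu>)) * exp (- (\<nu> / 2) * (cmod w)\<^sup>2)) * indicator A w"
      using K \<nu> by (simp add: indicator_def ennreal_mult'[symmetric] mult_ac)
    also have "K * (pi / (2 * \<nu>)) = \<nu> / 2 / pi"
      using \<nu> by (simp add: K_def field_simps power2_eq_square)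
    finally show "(\<integral>\<^sup>+z. G z (w - z) \<partial>lborel)
        = ennreal (\<nu> / 2 / pi * exp (- (\<nu> / 2) * (cmod w)\<^sup>2)) * indicator A w" .
  qed
  also have "\<dots> = emeasure (gauss (\<nu> / 2)) A"
    using \<nu> by (simp add: gauss_def emeasure_density)
  finally show "emeasure (distr (gauss \<nu>) borel (\<lambda>Z. bc_fst Z + c * bc_snd Z)) A = emeasure (gauss (\<nu> / 2)) A" .
qed simp

section \<open>Orthonormal sequences of square integrable functions\<close>

definition sq_integrable :: "'a measure \<Rightarrow> ('a \<Rightarrow> complex) \<Rightarrow> bool" where
  "sq_integrable M f \<longleftrightarrow> f \<in> borel_measurable M \<and> integrable M (\<lambda>x. (cmod (f x))\<^sup>2)"

lemma sq_integrable_measurable [measurable_dest]: "sq_integrable M f \<Longrightarrow> f \<in> borel_measurable M"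
  and sq_integrableD: "sq_integrable M f \<Longrightarrow> integrable M (\<lambda>x. (cmod (f x))\<^sup>2)"
  by (simp_all add: sq_integrable_def)

lemma borel_measurable_cnj [measurable (raw)]:
  "f \<in> borel_measurable M \<Longrightarrow> (\<lambda>x. cnj (f x)) \<in> borel_measurable M"
  by (rule measurable_compose[where N = borel])
     (auto intro!: borel_measurable_continuous_onI continuous_intros)

lemma sq_integrable_cnj: "sq_integrable M f \<Longrightarrow> sq_integrable M (\<lambda>x. cnj (f x))"
  by (auto simp: sq_integrable_def)

lemma integrable_mult_sq_integrable:
  assumes "sq_integrable M f" "sq_integrable M g"
  shows "integrable M (\<lambda>x. f x * g x)"
proof (rule Bochner_Integration.integrable_bound)
  show "integrable M (\<lambda>x. (cmod (f x))\<^sup>2 + (cmod (g x))\<^sup>2)"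
    using assms by (auto simp: sq_integrable_def)
  show "(\<lambda>x. f x * g x) \<in> borel_measurable M"
    using assms by measurable
  have "a * b \<le> a\<^sup>2 + b\<^sup>2" if "a \<ge> 0" "b \<ge> 0" for a b :: real
    using sum_squares_bound[of a b] mult_nonneg_nonneg[OF that] by linarith
  then show "AE x in M. norm (f x * g x) \<le> norm ((cmod (f x))\<^sup>2 + (cmod (g x))\<^sup>2)"
    by (simp add: norm_mult)
qed

lemma sq_integrable_zero: "sq_integrable M (\<lambda>_. 0)"
  by (simp add: sq_integrable_def)

lemma sq_integrable_cmult: "sq_integrable M f \<Longrightarrow> sq_integrable M (\<lambda>x. c * f x)"
  by (auto simp: sq_integrable_def norm_mult power_mult_distrib)

lemma sq_integrable_add:
  assumes "sq_integrable M f" "sq_integrable M g"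
  shows "sq_integrable M (\<lambda>x. f x + g x)"
  unfolding sq_integrable_def
proof
  show "(\<lambda>x. f x + g x) \<in> borel_measurable M"
    using assms by measurable
  show "integrable M (\<lambda>x. (cmod (f x + g x))\<^sup>2)"
  proof (rule Bochner_Integration.integrable_bound)
    show "integrable M (\<lambda>x. 2 * (cmod (f x))\<^sup>2 + 2 * (cmod (g x))\<^sup>2)"
      using assms by (auto simp: sq_integrable_def)
    have "(cmod (a + b))\<^sup>2 \<le> 2 * (cmod a)\<^sup>2 + 2 * (cmod b)\<^sup>2" for a b
    proof -
      have "(cmod (a + b))\<^sup>2 \<le> (cmod a + cmod b)\<^sup>2"
        by (intro power_mono norm_triangle_ineq) simp
      also have "\<dots> \<le> 2 * (cmod a)\<^sup>2 + 2 * (cmod b)\<^sup>2"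
        using sum_squares_bound[of "cmod a" "cmod b"] by (simp add: power2_sum)
      finally show ?thesis .
    qed
    then show "AE x in M. norm ((cmod (f x + g x))\<^sup>2) \<le> norm (2 * (cmod (f x))\<^sup>2 + 2 * (cmod (g x))\<^sup>2)"
      by simp
  qed (use assms in measurable)
qed

lemma sq_integrable_diff:
  "sq_integrable M f \<Longrightarrow> sq_integrable M g \<Longrightarrow> sq_integrable M (\<lambda>x. f x - g x)"
  using sq_integrable_add[of M f "\<lambda>x. (-1) * g x"] sq_integrable_cmult[of M g "-1"] by simp

lemma sq_integrable_sum:
  "(\<And>i. i \<in> A \<Longrightarrow> sq_integrable M (f i)) \<Longrightarrow> sq_integrable M (\<lambda>x. \<Sum>i\<in>A. f i x)"
  by (induction A rule: infinite_finite_induct) (auto intro: sq_integrable_zero sq_integrable_add)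

lemma sq_integrable_nn_integralI:
  assumes "f \<in> borel_measurable M" "(\<integral>\<^sup>+x. ennreal ((cmod (f x))\<^sup>2) \<partial>M) \<le> ennreal C"
  shows "sq_integrable M f" and "C \<ge> 0 \<Longrightarrow> (LINT x|M. (cmod (f x))\<^sup>2) \<le> C"
proof -
  show sq: "sq_integrable M f"
    using assms le_less_trans[OF assms(2), of \<infinity>]
    by (auto simp: sq_integrable_def integrable_iff_bounded)
  show "(LINT x|M. (cmod (f x))\<^sup>2) \<le> C" if "C \<ge> 0"
    using assms(2) that nn_integral_eq_integral[OF sq_integrableD[OF sq]] by simp
qed

lemma Cauchy_Schwarz_sq_integrable:
  assumes "sq_integrable M f" "sq_integrable M g"
  shows "(cmod (LINT x|M. f x * g x))\<^sup>2 \<le> (LINT x|M. (cmod (f x))\<^sup>2) * (LINT x|M. (cmod (g x))\<^sup>2)"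
proof -
  note [measurable] = sq_integrable_measurable[OF assms(1)] sq_integrable_measurable[OF assms(2)]
  note fg = integrable_mult_sq_integrable[OF assms]
  have "cmod (LINT x|M. f x * g x) \<le> (LINT x|M. cmod (f x * g x))"
    by (rule integral_norm_bound)
  then have "(cmod (LINT x|M. f x * g x))\<^sup>2 \<le> (LINT x|M. cmod (f x) * cmod (g x))\<^sup>2"
    by (intro power_mono) (simp_all add: norm_mult)
  moreover have "ennreal ((LINT x|M. cmod (f x) * cmod (g x))\<^sup>2)
      = (\<integral>\<^sup>+x. ennreal (cmod (f x)) * ennreal (cmod (g x)) \<partial>M)\<^sup>2"
    using integrable_norm[OF fg]
    by (simp add: norm_mult nn_integral_eq_integral ennreal_power flip: ennreal_mult)
  moreover have "\<dots> \<le> (\<integral>\<^sup>+x. (ennreal (cmod (f x)))\<^sup>2 \<partial>M) * (\<integral>\<^sup>+x. (ennreal (cmod (g x)))\<^sup>2 \<partial>M)"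
    by (rule Cauchy_Schwarz_nn_integral) measurable
  moreover have "\<dots> = ennreal ((LINT x|M. (cmod (f x))\<^sup>2) * (LINT x|M. (cmod (g x))\<^sup>2))"
    using assms[THEN sq_integrableD]
    by (simp add: ennreal_power nn_integral_eq_integral ennreal_mult)
  ultimately show ?thesis
    by (smt (verit) ennreal_le_iff Bochner_Integration.integral_nonneg mult_nonneg_nonneg zero_le_power2)
qed

locale orthonormal_sequence =
  fixes M :: "'a measure" and e :: "nat \<Rightarrow> 'a \<Rightarrow> complex"
  assumes sq: "sq_integrable M (e n)"
    and orthonormal: "(LINT x|M. e m x * cnj (e n x)) = (if m = n then 1 else 0)"
begin

definition coeff :: "('a \<Rightarrow> complex) \<Rightarrow> nat \<Rightarrow> complex" where
  "coeff f n = (LINT x|M. f x * cnj (e n x))"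

definition comb :: "(nat \<Rightarrow> complex) \<Rightarrow> nat set \<Rightarrow> 'a \<Rightarrow> complex" where
  "comb b A x = (\<Sum>n\<in>A. b n * e n x)"

lemma sq_comb: "sq_integrable M (comb b A)"
  unfolding comb_def [abs_def] by (intro sq_integrable_sum sq_integrable_cmult sq)

lemma integrable_coeff: "sq_integrable M f \<Longrightarrow> integrable M (\<lambda>x. f x * cnj (e n x))"
  by (intro integrable_mult_sq_integrable sq_integrable_cnj sq)

lemma coeff_diff:
  "sq_integrable M f \<Longrightarrow> sq_integrable M g \<Longrightarrow> coeff (\<lambda>x. f x - g x) n = coeff f n - coeff g n"
  by (simp add: coeff_def integrable_coeff left_diff_distrib)

lemma coeff_comb: "finite A \<Longrightarrow> coeff (comb b A) n = (if n \<in> A then b n else 0)"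
proof -
  assume A: "finite A"
  have "coeff (comb b A) n = (LINT x|M. (\<Sum>m\<in>A. b m * (e m x * cnj (e n x))))"
    by (simp add: coeff_def comb_def sum_distrib_right mult.assoc)
  also have "\<dots> = (\<Sum>m\<in>A. b m * (LINT x|M. e m x * cnj (e n x)))"
    by (subst Bochner_Integration.integral_sum) (auto intro!: integrable_coeff sq)
  also have "\<dots> = (\<Sum>m\<in>A. if m = n then b m else 0)"
    by (intro sum.cong) (auto simp: orthonormal)
  finally show ?thesis using A by simp
qed

lemma inner_comb:
  assumes f: "sq_integrable M f" and A: "finite A"
  shows "(LINT x|M. f x * cnj (comb b A x)) = (\<Sum>n\<in>A. cnj (b n) * coeff f n)"
proof -
  have "(LINT x|M. f x * cnj (comb b A x)) = (LINT x|M. (\<Sum>n\<in>A. cnj (b n) * (f x * cnj (e n x))))"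
    by (simp add: comb_def sum_distrib_left mult_ac)
  also have "\<dots> = (\<Sum>n\<in>A. cnj (b n) * coeff f n)"
    by (subst Bochner_Integration.integral_sum) (auto intro!: integrable_coeff f simp: coeff_def)
  finally show ?thesis .
qed

lemma norm_comb: 
  assumes "finite A"
  shows "(LINT x|M. (cmod (comb b A x))\<^sup>2) = (\<Sum>n\<in>A. (cmod (b n))\<^sup>2)"
proof -
  have "complex_of_real (LINT x|M. (cmod (comb b A x))\<^sup>2) = (LINT x|M. comb b A x * cnj (comb b A x))"
    by (simp only: complex_norm_square[symmetric] integral_complex_of_real)
  also have "\<dots> = of_real (\<Sum>n\<in>A. (cmod (b n))\<^sup>2)"
    using assms by (simp add: inner_comb[OF sq_comb] coeff_comb complex_norm_square mult.commute del: of_real_power)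
  finally show ?thesis using of_real_eq_iff by blast
qed

text \<open>
  The combination of \<open>e\<^sub>n\<close>, \<open>n \<in> A\<close>, with the coefficients of \<open>f\<close> is the orthogonal projection of \<open>f\<close>, so
  this is Pythagoras' theorem.
\<close>

lemma norm_diff_comb_coeff:
  assumes f: "sq_integrable M f" and A: "finite A"
  shows "(LINT x|M. (cmod (f x - comb (coeff f) A x))\<^sup>2)
    = (LINT x|M. (cmod (f x))\<^sup>2) - (\<Sum>n\<in>A. (cmod (coeff f n))\<^sup>2)"
proof -
  let ?g = "comb (coeff f) A"
  have eq: "(cmod (f x - ?g x))\<^sup>2 = (cmod (f x))\<^sup>2 + (cmod (?g x))\<^sup>2 - 2 * Re (f x * cnj (?g x))" for x
    unfolding cmod_power2 by (simp add: power2_eq_square algebra_simps)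
  have i: "integrable M (\<lambda>x. f x * cnj (?g x))"
    by (intro integrable_mult_sq_integrable f sq_integrable_cnj sq_comb)
  have "(LINT x|M. Re (f x * cnj (?g x))) = Re (LINT x|M. f x * cnj (?g x))"
    by (rule integral_Re[OF i])
  also have "\<dots> = (\<Sum>n\<in>A. (cmod (coeff f n))\<^sup>2)"
    unfolding inner_comb[OF f A] Re_sum cmod_power2 by (simp add: power2_eq_square)
  finally have re: "(LINT x|M. Re (f x * cnj (?g x))) = (\<Sum>n\<in>A. (cmod (coeff f n))\<^sup>2)" .
  show ?thesis
    unfolding eq using i sq_integrableD[OF f] sq_integrableD[OF sq_comb[of "coeff f" A]]
    by (subst Bochner_Integration.integral_diff) (auto simp: re norm_comb[OF A] simp del: times_complex.sel)
qed

lemma bessel_inequality: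
  assumes "sq_integrable M f" "finite A"
  shows "(\<Sum>n\<in>A. (cmod (coeff f n))\<^sup>2) \<le> (LINT x|M. (cmod (f x))\<^sup>2)"
  using norm_diff_comb_coeff[OF assms] Bochner_Integration.integral_nonneg[of M "\<lambda>x. (cmod (f x - comb (coeff f) A x))\<^sup>2"] by simp

lemma summable_coeff: "sq_integrable M f \<Longrightarrow> summable (\<lambda>n. (cmod (coeff f n))\<^sup>2)"
  by (rule bounded_imp_summable[where B = "LINT x|M. (cmod (f x))\<^sup>2"]) (auto intro: bessel_inequality)

text \<open>
  The partial sums are Cauchy in \<open>L\<^sup>2\<close>. A subsequence \<open>S\<^sub>k\<close> whose successive differences have squared norm
  at most \<open>4\<^sup>-\<^sup>k\<close> converges almost everywhere, and by Fatou's lemma the pointwise limit is also the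
  limit in \<open>L\<^sup>2\<close>; its coefficients are those prescribed.
\<close>

lemma riesz_fischer:
  assumes b: "summable (\<lambda>n. (cmod (b n))\<^sup>2)"
  obtains f where "sq_integrable M f" "\<And>n. coeff f n = b n"
    "(LINT x|M. (cmod (f x))\<^sup>2) = (\<Sum>n. (cmod (b n))\<^sup>2)"
proof -
  note [measurable] = sq_integrable_measurable[OF sq_comb]
  have "\<exists>N. \<forall>m\<ge>N. \<forall>n. (\<Sum>i\<in>{m..<n}. (cmod (b i))\<^sup>2) \<le> (1/4) ^ k" for k
  proof -
    have "\<exists>N. \<forall>m\<ge>N. \<forall>n. norm (\<Sum>i\<in>{m..<n}. (cmod (b i))\<^sup>2) < (1/4) ^ k"
      using b[unfolded summable_Cauchy, rule_format, of "(1/4) ^ k"] by simp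
    then show ?thesis
      by (simp add: sum_nonneg) (blast intro: less_imp_le)
  qed
  then obtain N where N: "(\<Sum>i\<in>{m..<n}. (cmod (b i))\<^sup>2) \<le> (1/4) ^ k" if "m \<ge> N k" for m n k
    by metis
  \<comment> \<open>summing the \<open>N j\<close> makes the indices monotone, adding \<open>k\<close> makes them unbounded\<close>
  define r where "r k = (\<Sum>j\<le>k. N j) + k" for k
  have r_Suc: "r k \<le> r (Suc k)" for k by (simp add: r_def)
  then have r_mono: "r j \<le> r k" if "j \<le> k" for j k
    using lift_Suc_mono_le[of r] that by blast
  have r_ge: "r k \<ge> N k" "r k \<ge> k" for k
    using member_le_sum[of k "{..k}" N] by (auto simp: r_def)
  define S where "S k = comb b {..<r k}" for k
  have S_diff: "S k x - S j x = comb b {r j..<r k} x" if "j \<le> k" for j k x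
    unfolding S_def comb_def using sum_diff[of "{..<r k}" "{..<r j}" "\<lambda>n. b n * e n x"] r_mono[OF that]
    by (simp add: ivl_disj_un lessThan_minus_lessThan)
  have [measurable]: "S k \<in> borel_measurable M" for k
    unfolding S_def by measurable
  have S_norm: "(\<integral>\<^sup>+x. ennreal ((cmod (S k x - S j x))\<^sup>2) \<partial>M) \<le> ennreal ((1/4) ^ j)" if "j \<le> k" for j k
    unfolding S_diff[OF that]
    by (subst nn_integral_eq_integral[OF sq_integrableD[OF sq_comb]])
       (auto simp: norm_comb intro!: ennreal_leI N r_ge)
  define d where "d k x = S (Suc k) x - S k x" for k x
  have [measurable]: "d k \<in> borel_measurable M" for k
    unfolding d_def [abs_def] by measurable
  \<comment> \<open>On a space of infinite measure \<open>L\<^sup>2\<close> bounds say nothing about the integral of \<open>|d\<^sub>k|\<close>. The weighted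
    squares have a finite sum almost everywhere, and they bound \<open>|d\<^sub>k|\<close> up to a geometric series.\<close>
  have "(\<integral>\<^sup>+x. (\<Sum>k. ennreal (2 ^ k * (cmod (d k x))\<^sup>2)) \<partial>M)
      = (\<Sum>k. \<integral>\<^sup>+x. ennreal (2 ^ k * (cmod (d k x))\<^sup>2) \<partial>M)"
    by (rule nn_integral_suminf) measurable
  also have "\<dots> \<le> (\<Sum>k. ennreal ((1/2) ^ k))"
  proof (intro suminf_le allI)
    fix k
    have "(\<integral>\<^sup>+x. ennreal (2 ^ k * (cmod (d k x))\<^sup>2) \<partial>M) \<le> ennreal (2 ^ k) * ennreal ((1/4) ^ k)"
      using S_norm[of k "Suc k"] by (simp add: ennreal_mult nn_integral_cmult d_def mult_left_mono)
    also have "\<dots> = ennreal ((1/2) ^ k)"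
      by (simp add: ennreal_mult[symmetric] power_mult_distrib[symmetric])
    finally show "(\<integral>\<^sup>+x. ennreal (2 ^ k * (cmod (d k x))\<^sup>2) \<partial>M) \<le> ennreal ((1/2) ^ k)" .
  qed auto
  also have "\<dots> = ennreal 2"
    by (subst suminf_ennreal2) (auto simp: suminf_geometric)
  also have "ennreal 2 < \<infinity>"
    by simp
  finally have fin: "(\<integral>\<^sup>+x. (\<Sum>k. ennreal (2 ^ k * (cmod (d k x))\<^sup>2)) \<partial>M) \<noteq> \<infinity>"
    by (rule less_imp_neq)
  have "AE x in M. (\<Sum>k. ennreal (2 ^ k * (cmod (d k x))\<^sup>2)) \<noteq> \<infinity>"
    by (rule nn_integral_PInf_AE[OF _ fin]) measurable
  then have conv: "AE x in M. (\<lambda>k. S k x) \<longlonglongrightarrow> lim (\<lambda>k. S k x)"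
  proof eventually_elim
    fix x assume "(\<Sum>k. ennreal (2 ^ k * (cmod (d k x))\<^sup>2)) \<noteq> \<infinity>"
    then have "summable (\<lambda>k. 2 ^ k * (cmod (d k x))\<^sup>2)"
      by (intro summable_suminf_not_top) auto
    then have sum: "summable (\<lambda>k. (1/2) ^ k + 2 ^ k * (cmod (d k x))\<^sup>2)"
      by (intro summable_add summable_geometric) auto
    have "summable (\<lambda>k. d k x)"
    proof (rule summable_comparison_test[OF _ sum], intro exI allI impI)
      fix k :: nat
      show "norm (d k x) \<le> (1/2) ^ k + 2 ^ k * (cmod (d k x))\<^sup>2"
      proof (cases "cmod (d k x) \<le> (1/2) ^ k")
        case False
        then have "1 \<le> 2 ^ k * cmod (d k x)"
          by (simp add: field_simps)
        then have "cmod (d k x) * 1 \<le> cmod (d k x) * (2 ^ k * cmod (d k x))"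
          by (intro mult_left_mono) auto
        then show ?thesis
          by (simp add: power2_eq_square mult_ac add_increasing)
      qed (simp add: add_increasing2)
    qed
    then have "(\<lambda>n. S 0 x + (\<Sum>k<n. d k x)) \<longlonglongrightarrow> S 0 x + (\<Sum>k. d k x)"
      by (intro tendsto_intros summable_LIMSEQ)
    moreover have "S 0 x + (\<Sum>k<n. d k x) = S n x" for n
      unfolding d_def sum_lessThan_telescope[of "\<lambda>k. S k x"] by simp
    ultimately show "(\<lambda>k. S k x) \<longlonglongrightarrow> lim (\<lambda>k. S k x)"
      by (simp add: limI)
  qed
  define f where "f x = lim (\<lambda>k. S k x)" for x
  have [measurable]: "f \<in> borel_measurable M"
    unfolding f_def [abs_def] by (rule borel_measurable_lim_metric) measurable
  have f_S: "(\<integral>\<^sup>+x. ennreal ((cmod (f x - S j x))\<^sup>2) \<partial>M) \<le> ennreal ((1/4) ^ j)" for j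
  proof -
    have "(\<integral>\<^sup>+x. ennreal ((cmod (f x - S j x))\<^sup>2) \<partial>M)
        = (\<integral>\<^sup>+x. liminf (\<lambda>k. ennreal ((cmod (S k x - S j x))\<^sup>2)) \<partial>M)"
      using conv
    proof (intro nn_integral_cong_AE, eventually_elim)
      fix x assume "(\<lambda>k. S k x) \<longlonglongrightarrow> lim (\<lambda>k. S k x)"
      then have "(\<lambda>k. ennreal ((cmod (S k x - S j x))\<^sup>2)) \<longlonglongrightarrow> ennreal ((cmod (f x - S j x))\<^sup>2)"
        unfolding f_def by (intro tendsto_intros tendsto_ennrealI)
      then show "ennreal ((cmod (f x - S j x))\<^sup>2) = liminf (\<lambda>k. ennreal ((cmod (S k x - S j x))\<^sup>2))"
        by (intro lim_imp_Liminf[symmetric]) simp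
    qed
    also have "\<dots> \<le> liminf (\<lambda>k. \<integral>\<^sup>+x. ennreal ((cmod (S k x - S j x))\<^sup>2) \<partial>M)"
      by (rule nn_integral_liminf) measurable
    also have "\<dots> \<le> liminf (\<lambda>k. ennreal ((1/4) ^ j))"
      by (intro Liminf_mono eventually_sequentiallyI[of j] S_norm)
    also have "\<dots> = ennreal ((1/4) ^ j)"
      by (simp add: Liminf_const)
    finally show ?thesis .
  qed
  have sq_diff: "sq_integrable M (\<lambda>x. f x - S j x)"
    and norm_diff: "(LINT x|M. (cmod (f x - S j x))\<^sup>2) \<le> (1/4) ^ j" for j
    using sq_integrable_nn_integralI[OF _ f_S[of j]] by auto
  have S: "sq_integrable M (S j)" for j
    unfolding S_def by (rule sq_comb)
  have f: "sq_integrable M f"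
    using sq_integrable_add[OF sq_diff[of 0] S[of 0]] by simp
  have coeff: "coeff f n = b n" for n
  proof -
    have "cmod (coeff f n - b n) \<le> (1/2) ^ j" if "j > n" for j
    proof -
      have "coeff f n - b n = coeff f n - coeff (S j) n"
        using r_ge(2)[of j] that by (simp add: S_def coeff_comb)
      also have "\<dots> = coeff (\<lambda>x. f x - S j x) n"
        by (rule coeff_diff[symmetric]) (fact f S)+
      finally have "(cmod (coeff f n - b n))\<^sup>2
          \<le> (LINT x|M. (cmod (f x - S j x))\<^sup>2) * (LINT x|M. (cmod (cnj (e n x)))\<^sup>2)"
        unfolding coeff_def by (simp only: Cauchy_Schwarz_sq_integrable[OF sq_diff sq_integrable_cnj[OF sq]])
      also have "(LINT x|M. (cmod (cnj (e n x)))\<^sup>2) = 1"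
        using norm_comb[of "{n}" "\<lambda>_. 1"] by (simp add: comb_def)
      finally have "(cmod (coeff f n - b n))\<^sup>2 \<le> (1/4) ^ j"
        using norm_diff[of j] by simp
      also have "(1/4 :: real) ^ j = ((1/2) ^ j)\<^sup>2"
        by (simp add: power2_eq_square flip: power_mult_distrib)
      finally have "(cmod (coeff f n - b n))\<^sup>2 \<le> ((1/2) ^ j)\<^sup>2" .
      then show ?thesis
        by (rule power2_le_imp_le) simp
    qed
    moreover have "(\<lambda>j. (1/2) ^ j :: real) \<longlonglongrightarrow> 0"
      by (rule LIMSEQ_power_zero) simp
    ultimately have "cmod (coeff f n - b n) \<le> 0"
      by (intro LIMSEQ_le_const[of "\<lambda>j. (1/2) ^ j"]) (auto intro!: exI[of _ "Suc n"])
    then show ?thesis by simp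
  qed
  have le: "(LINT x|M. (cmod (f x))\<^sup>2) \<le> (\<Sum>n. (cmod (b n))\<^sup>2) + (1/4) ^ j" for j
  proof -
    have "(LINT x|M. (cmod (f x - S j x))\<^sup>2) = (LINT x|M. (cmod (f x))\<^sup>2) - (\<Sum>n<r j. (cmod (b n))\<^sup>2)"
      using norm_diff_comb_coeff[OF f, of "{..<r j}"] coeff by (simp add: S_def ext[of "coeff f" b])
    moreover have "(\<Sum>n<r j. (cmod (b n))\<^sup>2) \<le> (\<Sum>n. (cmod (b n))\<^sup>2)"
      by (rule sum_le_suminf[OF b]) auto
    ultimately show ?thesis using norm_diff[of j] by linarith
  qed
  have "(\<lambda>j. (\<Sum>n. (cmod (b n))\<^sup>2) + (1/4) ^ j) \<longlonglongrightarrow> (\<Sum>n. (cmod (b n))\<^sup>2) + 0"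
    by (intro tendsto_add tendsto_const LIMSEQ_power_zero) simp
  then have "(LINT x|M. (cmod (f x))\<^sup>2) \<le> (\<Sum>n. (cmod (b n))\<^sup>2)"
    using le by (intro LIMSEQ_le_const[of _ _ "LINT x|M. (cmod (f x))\<^sup>2"]) auto
  moreover have "(\<Sum>n. (cmod (b n))\<^sup>2) \<le> (LINT x|M. (cmod (f x))\<^sup>2)"
    using bessel_inequality[OF f] coeff by (intro suminf_le_const[OF b]) simp
  ultimately show thesis
    using that f coeff by simp
qed

text \<open>
  Riesz--Fischer provides a \<open>g\<close> with the same coefficients as \<open>f\<close> and with the norm predicted by Parseval;
  completeness identifies \<open>g\<close> with \<open>f\<close>.
\<close>

lemma parseval:
  assumes complete: "\<And>g. sq_integrable M g \<Longrightarrow> (\<And>n. coeff g n = 0) \<Longrightarrow> AE x in M. g x = 0"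
    and f: "sq_integrable M f"
  shows "(LINT x|M. (cmod (f x))\<^sup>2) = (\<Sum>n. (cmod (coeff f n))\<^sup>2)"
proof -
  obtain g where g: "sq_integrable M g" "\<And>n. coeff g n = coeff f n"
    "(LINT x|M. (cmod (g x))\<^sup>2) = (\<Sum>n. (cmod (coeff f n))\<^sup>2)"
    using riesz_fischer[OF summable_coeff[OF f]] by blast
  have "AE x in M. f x - g x = 0"
    using f g by (intro complete sq_integrable_diff) (auto simp: coeff_diff)
  then have "(LINT x|M. (cmod (f x))\<^sup>2) = (LINT x|M. (cmod (g x))\<^sup>2)"
    using f g(1) by (intro integral_cong_AE) (measurable, auto simp: sq_integrable_measurable)
  then show ?thesis using g by simp
qed

end

section \<open>Uniqueness of the Fourier transform\<close>

text \<open>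
  The positive and the negative part of \<open>g\<close> have the same Fourier transform, in particular the same mass.
  Normalized, they are densities of probability measures with the same characteristic function, hence
  equal by Levy's uniqueness theorem; but two functions with disjoint supports are equal only if both vanish.
\<close>

lemma AE_zero_if_fourier_zero_real:
  fixes g :: "real \<Rightarrow> real"
  assumes g: "integrable lborel g"
    and zero: "\<And>t. (LINT x|lborel. iexp (t * x) * of_real (g x)) = 0"
  shows "AE x in lborel. g x = 0"
proof -
  define p where "p x = max 0 (g x)" for x
  define q where "q x = max 0 (- g x)" for x
  note [measurable] = borel_measurable_integrable[OF g]
  have p: "integrable lborel p" "p \<in> borel_measurable borel" and q: "integrable lborel q" "q \<in> borel_measurable borel"
    using g by (auto simp: p_def [abs_def] q_def [abs_def])
  have pq: "g x = p x - q x" and p0: "p x \<ge> 0" and q0: "q x \<ge> 0" for x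
    by (auto simp: p_def q_def)
  have int: "integrable lborel (\<lambda>x. iexp (t * x) * of_real (f x))" if "integrable lborel f" for t f
    by (rule Bochner_Integration.integrable_bound[OF that])
       (use borel_measurable_integrable[OF that] in \<open>auto simp: norm_mult\<close>)
  have eq: "(LINT x|lborel. iexp (t * x) * of_real (p x)) = (LINT x|lborel. iexp (t * x) * of_real (q x))" for t
    using zero[of t] int[OF p(1)] int[OF q(1)]
    by (simp add: pq right_diff_distrib del: of_real_mult)
  define m where "m = (LINT x|lborel. p x)"
  have "complex_of_real (LINT x|lborel. p x) = of_real (LINT x|lborel. q x)"
    using eq[of 0] by simp
  then have m: "(LINT x|lborel. q x) = m"
    unfolding of_real_eq_iff m_def by simp
  show ?thesis
  proof (cases "m = 0")
    case True
    then have "AE x in lborel. p x = 0" "AE x in lborel. q x = 0"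
      using integral_nonneg_eq_0_iff_AE[OF p(1)] integral_nonneg_eq_0_iff_AE[OF q(1)] p0 q0 m m_def by auto
    then show ?thesis
      by eventually_elim (simp add: pq)
  next
    case False
    moreover have "m \<ge> 0"
      unfolding m_def using p0 by simp
    ultimately have m0: "m > 0" by simp
    have dist: "real_distribution (density lborel (\<lambda>x. ennreal (f x / m)))"
      if "integrable lborel f" "\<And>x. f x \<ge> 0" "(LINT x|lborel. f x) = m" for f
    proof -
      have "f \<in> borel_measurable borel"
        using borel_measurable_integrable[OF that(1)] by simp
      then have "emeasure (density lborel (\<lambda>x. ennreal (f x / m))) UNIV = 1"
        using that m0 by (simp add: emeasure_density nn_integral_eq_integral)
      then show ?thesis
        by (auto simp: real_distribution_def real_distribution_axioms_def intro!: prob_spaceI)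
    qed
    have char: "char (density lborel (\<lambda>x. ennreal (f x / m))) t = (LINT x|lborel. iexp (t * x) * of_real (f x)) / of_real m"
      if "f \<in> borel_measurable borel" "\<And>x. f x \<ge> 0" for f t
      using that m0 unfolding char_def
      by (subst integral_density) (auto simp: scaleR_conv_of_real mult_ac)
    have "density lborel (\<lambda>x. ennreal (p x / m)) = density lborel (\<lambda>x. ennreal (q x / m))"
      using dist[OF p(1) p0 m_def[symmetric]] dist[OF q(1) q0 m]
      by (rule Levy_uniqueness) (rule ext, simp only: char p q p0 q0 eq)
    then have "AE x in lborel. ennreal (p x / m) = ennreal (q x / m)"
      using p(2) q(2) by (intro sigma_finite_measure.density_unique[OF sigma_finite_lborel]) auto
    then show ?thesis
      by eventually_elim (use m0 p0 q0 in \<open>simp add: pq divide_nonneg_pos\<close>)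
  qed
qed

text \<open>
  The hypothesis passes to the complex conjugate of \<open>g\<close>, by changing the sign of \<open>t\<close>, and hence to the
  real and the imaginary part.
\<close>

lemma AE_zero_if_fourier_zero:
  fixes g :: "real \<Rightarrow> complex"
  assumes g: "integrable lborel g"
    and zero: "\<And>t. (LINT x|lborel. iexp (t * x) * g x) = 0"
  shows "AE x in lborel. g x = 0"
proof -
  have int: "integrable lborel (\<lambda>x. iexp (t * x) * f x)" if "integrable lborel f" for t and f :: "real \<Rightarrow> complex"
    by (rule Bochner_Integration.integrable_bound[OF that])
       (use borel_measurable_integrable[OF that] in \<open>auto simp: norm_mult\<close>)
  have zero': "(LINT x|lborel. iexp (t * x) * cnj (g x)) = 0" for t
  proof -
    have "(LINT x|lborel. iexp (t * x) * cnj (g x)) = (LINT x|lborel. cnj (iexp ((- t) * x) * g x))"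
      by (simp add: exp_cnj)
    also have "\<dots> = cnj (LINT x|lborel. iexp ((- t) * x) * g x)"
      by (rule Bochner_Integration.integral_cnj)
    finally show ?thesis
      by (simp only: zero complex_cnj_zero)
  qed
  have cg: "integrable lborel (\<lambda>x. cnj (g x))"
    using g by simp
  have "AE x in lborel. Re (g x) = 0"
  proof (rule AE_zero_if_fourier_zero_real)
    fix t :: real
    have "iexp (t * x) * of_real (Re (g x)) = (iexp (t * x) * g x + iexp (t * x) * cnj (g x)) / 2" for x
      unfolding distrib_left[symmetric] complex_add_cnj by simp
    then show "(LINT x|lborel. iexp (t * x) * of_real (Re (g x))) = 0"
      using int[OF g, of t] int[OF cg, of t]
      by (simp only: integral_divide_zero Bochner_Integration.integral_add zero zero') simp
  qed (use g in auto)
  moreover have "AE x in lborel. Im (g x) = 0"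
  proof (rule AE_zero_if_fourier_zero_real)
    fix t :: real
    have "iexp (t * x) * of_real (Im (g x)) = (iexp (t * x) * g x - iexp (t * x) * cnj (g x)) / (2 * \<i>)" for x
      unfolding right_diff_distrib[symmetric] complex_diff_cnj by (simp add: field_simps)
    then show "(LINT x|lborel. iexp (t * x) * of_real (Im (g x))) = 0"
      using int[OF g, of t] int[OF cg, of t]
      by (simp only: integral_divide_zero Bochner_Integration.integral_diff zero zero') simp
  qed (use g in auto)
  ultimately show ?thesis
    by eventually_elim (simp add: complex_eq_iff)
qed

section \<open>Hermite polynomials\<close>

text \<open>Termwise integration, in the form in which generating functions provide it: the sum of the norms
  has an integrable bound.\<close>

lemma integral_sums_dominated:
  fixes f :: "nat \<Rightarrow> 'a \<Rightarrow> 'b::{banach, second_countable_topology}"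
  assumes meas: "\<And>i. f i \<in> borel_measurable M"
    and sums: "\<And>x. (\<lambda>i. f i x) sums F x"
    and g: "integrable M g" and bound: "\<And>x N. (\<Sum>i<N. norm (f i x)) \<le> g x"
  shows "integrable M (f i)" "integrable M F" "(\<lambda>i. LINT x|M. f i x) sums (LINT x|M. F x)"
proof -
  note [measurable] = meas
  have "norm (f i x) \<le> g x" for i x
    using member_le_sum[of i "{..<Suc i}" "\<lambda>j. norm (f j x)"] bound[where N = "Suc i" and x = x]
    by (simp del: sum.lessThan_Suc)
  then have "norm (f i x) \<le> norm (g x)" for i x
    using order_trans[OF _ abs_ge_self[of "g x"]] by simp
  then show int: "integrable M (f i)" for i
    by (intro Bochner_Integration.integrable_bound[OF g]) auto
  have lim: "AE x in M. (\<lambda>N. \<Sum>i<N. f i x) \<longlonglongrightarrow> F x"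
    using sums by (simp add: sums_def)
  have le: "AE x in M. norm (\<Sum>i<N. f i x) \<le> g x" for N
    by (intro AE_I2 order_trans[OF norm_sum bound])
  have [measurable]: "F \<in> borel_measurable M"
    by (rule borel_measurable_LIMSEQ_metric[of "\<lambda>N x. \<Sum>i<N. f i x"]) (use sums in \<open>auto simp: sums_def\<close>)
  show "integrable M F"
    by (rule integrable_dominated_convergence[OF _ _ g lim le]) measurable
  have "(\<lambda>N. LINT x|M. (\<Sum>i<N. f i x)) \<longlonglongrightarrow> (LINT x|M. F x)"
    by (rule integral_dominated_convergence[OF _ _ g lim le]) measurable
  then show "(\<lambda>i. LINT x|M. f i x) sums (LINT x|M. F x)"
    by (simp add: sums_def int)
qed

lemma powser_unique_real:
  fixes c d :: "nat \<Rightarrow> real"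
  assumes "R > 0" and c: "\<And>a. \<bar>a\<bar> < R \<Longrightarrow> (\<lambda>n. c n * a ^ n) sums F a"
    and d: "\<And>a. \<bar>a\<bar> < R \<Longrightarrow> (\<lambda>n. d n * a ^ n) sums F a"
  shows "c n = d n"
proof -
  have sums: "(\<lambda>n. (c n - d n) * (a - 0) ^ n) sums 0" if "norm (a - 0) < R" for a
    using sums_diff[OF c[of a] d[of a]] that by (simp add: left_diff_distrib)
  show ?thesis
  proof (cases "n = 0")
    case True
    then show ?thesis
      using c[of 0] d[of 0] \<open>R > 0\<close> by (auto simp: sums_iff powser_zero)
  next
    case False
    show ?thesis
    proof (rule ccontr)
      assume "c n \<noteq> d n"
      then obtain s where "s > 0" "\<And>z::real. z \<in> cball 0 s - {0} \<Longrightarrow> (0::real) \<noteq> 0"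
        using powser_0_nonzero[OF \<open>R > 0\<close> sums, of n] False by auto
      from this(2)[of s] this(1) show False by simp
    qed
  qed
qed

text \<open>
  The coefficient of \<open>z\<^sup>n\<close> in \<open>exp (s x z + q z\<^sup>2)\<close>, written as a Cauchy product. For \<open>s = 2\<close>,
  \<open>q = -1\<close> this is the Hermite polynomial \<open>H\<^sub>n(x)\<close> divided by \<open>n!\<close>.
\<close>

definition gauss_poly :: "real \<Rightarrow> real \<Rightarrow> nat \<Rightarrow> real \<Rightarrow> real" where
  "gauss_poly s q n x = (\<Sum>k\<le>n. (s * x) ^ k / fact k *
     (if even (n - k) then q ^ ((n - k) div 2) / fact ((n - k) div 2) else 0))"

lemma gauss_poly_sums:
  fixes z :: "'a::{real_normed_field, banach}"
  shows "(\<lambda>n. of_real (gauss_poly s q n x) * z ^ n) sums exp (of_real (s * x) * z + of_real q * z\<^sup>2)"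
proof -
  define a where "a k = (of_real (s * x) * z) ^ k /\<^sub>R fact k" for k
  define b where "b m = (if even m then (of_real q * z\<^sup>2) ^ (m div 2) /\<^sub>R fact (m div 2) else 0)" for m
  have a: "a sums exp (of_real (s * x) * z)"
    unfolding a_def by (rule exp_converges)
  have na: "summable (\<lambda>k. norm (a k))"
    unfolding a_def by (rule summable_norm_exp)
  have sm: "strict_mono (\<lambda>m::nat. 2 * m)"
    by (simp add: strict_mono_def)
  have odd: "m \<notin> range (\<lambda>m::nat. 2 * m) \<Longrightarrow> odd m" for m
    by (metis dvdE rangeI)
  have b: "b sums exp (of_real q * z\<^sup>2)"
    using exp_converges[of "of_real q * z\<^sup>2"]
    by (subst sums_mono_reindex[OF sm, symmetric]) (auto simp: b_def dest: odd)
  have "summable (\<lambda>m. norm (b (2 * m)))"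
    using summable_norm_exp[of "of_real q * z\<^sup>2"] by (simp add: b_def)
  then have nb: "summable (\<lambda>m. norm (b m))"
    by (subst (asm) summable_mono_reindex[OF sm]) (auto simp: b_def dest: odd)
  have "(\<lambda>n. \<Sum>k\<le>n. a k * b (n - k)) sums ((\<Sum>k. a k) * (\<Sum>m. b m))"
    by (rule Cauchy_product_sums[OF na nb])
  also have "(\<Sum>k. a k) * (\<Sum>m. b m) = exp (of_real (s * x) * z + of_real q * z\<^sup>2)"
    using a b by (simp add: sums_iff exp_add)
  also have "(\<lambda>n. \<Sum>k\<le>n. a k * b (n - k)) = (\<lambda>n. of_real (gauss_poly s q n x) * z ^ n)"
  proof
    fix n
    have "a k * b (n - k) = of_real ((s * x) ^ k / fact k *
        (if even (n - k) then q ^ ((n - k) div 2) / fact ((n - k) div 2) else 0)) * z ^ n"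
      if "k \<le> n" for k
    proof (cases "even (n - k)")
      case True
      then have "z ^ n = z ^ k * (z\<^sup>2) ^ ((n - k) div 2)"
        using that by (simp add: power_mult[symmetric] power_add[symmetric])
      then show ?thesis
        using True by (simp add: a_def b_def power_mult_distrib scaleR_conv_of_real field_simps)
    qed (simp add: b_def)
    then show "(\<Sum>k\<le>n. a k * b (n - k)) = of_real (gauss_poly s q n x) * z ^ n"
      unfolding gauss_poly_def of_real_sum sum_distrib_right by (intro sum.cong) auto
  qed
  finally show ?thesis .
qed

lemma abs_gauss_poly_le: "\<bar>gauss_poly s q n x\<bar> \<le> gauss_poly \<bar>s\<bar> \<bar>q\<bar> n \<bar>x\<bar>"
  unfolding gauss_poly_def
  by (intro order_trans[OF sum_abs] sum_mono) (simp add: abs_mult power_abs power_mult_distrib)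

text \<open>Making all signs positive in the generating function gives a majorant that is integrable for
  every Gaussian measure.\<close>

lemma sum_abs_gauss_poly_le:
  assumes "r \<ge> 0"
  shows "(\<Sum>n<N. \<bar>gauss_poly s q n x\<bar> * r ^ n) \<le> exp (\<bar>s\<bar> * \<bar>x\<bar> * r + \<bar>q\<bar> * r\<^sup>2)"
proof -
  have sums: "(\<lambda>n. gauss_poly \<bar>s\<bar> \<bar>q\<bar> n \<bar>x\<bar> * r ^ n) sums exp (\<bar>s\<bar> * \<bar>x\<bar> * r + \<bar>q\<bar> * r\<^sup>2)"
    using gauss_poly_sums[of "\<bar>s\<bar>" "\<bar>q\<bar>" "\<bar>x\<bar>" r] by simp
  have nonneg: "0 \<le> gauss_poly \<bar>s\<bar> \<bar>q\<bar> n \<bar>x\<bar> * r ^ n" for n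
    using assms order_trans[OF abs_ge_zero abs_gauss_poly_le[of s q n x]] by simp
  have "(\<Sum>n<N. \<bar>gauss_poly s q n x\<bar> * r ^ n) \<le> (\<Sum>n<N. gauss_poly \<bar>s\<bar> \<bar>q\<bar> n \<bar>x\<bar> * r ^ n)"
    using assms by (intro sum_mono mult_right_mono abs_gauss_poly_le) simp
  also have "\<dots> \<le> (\<Sum>n. gauss_poly \<bar>s\<bar> \<bar>q\<bar> n \<bar>x\<bar> * r ^ n)"
    using sums nonneg by (intro sum_le_suminf) (auto simp: sums_iff)
  finally show ?thesis
    using sums by (simp add: sums_iff)
qed

lemma gauss_poly_measurable [measurable]: "gauss_poly s q n \<in> borel_measurable borel"
  unfolding gauss_poly_def [abs_def] by measurable

lemma gauss_real_exp:
  fixes c :: real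
  assumes \<sigma>: "\<sigma> > 0"
  shows "integrable (gauss \<sigma>) (\<lambda>x. exp (c * x))" "(LINT x|gauss \<sigma>. exp (c * x)) = exp (c\<^sup>2 / (4 * \<sigma>))"
proof -
  have "(\<integral>\<^sup>+x. ennreal (exp (c * x)) \<partial>gauss \<sigma>)
      = (\<integral>\<^sup>+x. ennreal (sqrt (\<sigma> / pi) * exp (c\<^sup>2 / (4 * \<sigma>))) * ennreal (exp (- \<sigma> * (- (c / (2 * \<sigma>)) + x)\<^sup>2)) \<partial>lborel)"
  proof -
    have "c * x - \<sigma> * x\<^sup>2 = c\<^sup>2 / (4 * \<sigma>) - \<sigma> * (- (c / (2 * \<sigma>)) + x)\<^sup>2" for x
      using \<sigma> by (simp add: field_simps power2_eq_square)
    then show ?thesis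
      using \<sigma> unfolding gauss_def
      by (subst nn_integral_density)
         (auto simp: ennreal_mult'[symmetric] exp_add[symmetric] mult.assoc intro!: nn_integral_cong)
  qed
  also have "\<dots> = ennreal (sqrt (\<sigma> / pi) * exp (c\<^sup>2 / (4 * \<sigma>))) * ennreal (sqrt (pi / \<sigma>))"
    using nn_integral_lborel_translate[of "\<lambda>x. ennreal (exp (- \<sigma> * x\<^sup>2))" "- (c / (2 * \<sigma>))"]
      nn_integral_gaussian_real[OF \<sigma>] by (simp add: nn_integral_cmult)
  also have "\<dots> = ennreal (exp (c\<^sup>2 / (4 * \<sigma>)))"
    using \<sigma> by (simp add: ennreal_mult'[symmetric] real_sqrt_divide)
  finally have eq: "(\<integral>\<^sup>+x. ennreal (exp (c * x)) \<partial>gauss \<sigma>) = ennreal (exp (c\<^sup>2 / (4 * \<sigma>)))" .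
  show int: "integrable (gauss \<sigma>) (\<lambda>x. exp (c * x))"
    by (rule integrableI_nonneg) (auto simp: eq)
  then show "(LINT x|gauss \<sigma>. exp (c * x)) = exp (c\<^sup>2 / (4 * \<sigma>))"
    using eq by (simp add: nn_integral_eq_integral)
qed

lemma gauss_real_exp_abs:
  fixes c :: real
  assumes \<sigma>: "\<sigma> > 0"
  shows "integrable (gauss \<sigma>) (\<lambda>x. exp (c * \<bar>x\<bar>))"
proof (rule Bochner_Integration.integrable_bound)
  show "integrable (gauss \<sigma>) (\<lambda>x. exp (c * x) + exp ((- c) * x))"
    by (intro Bochner_Integration.integrable_add gauss_real_exp \<sigma>)
  have "exp (c * \<bar>x\<bar>) \<le> exp (c * x) + exp (- c * x)" for x
    by (cases "x \<ge> 0") auto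
  then show "AE x in gauss \<sigma>. norm (exp (c * \<bar>x\<bar>)) \<le> norm (exp (c * x) + exp (- c * x))"
    by (intro AE_I2) (simp add: order_trans[OF _ abs_ge_self])
qed measurable

text \<open>
  Let \<open>K a\<close> be the generating function at \<open>a\<close>. The choice of \<open>q\<close> cancels the pure squares in the Gaussian
  integral of \<open>K a * K b\<close>, which is \<open>exp (c a b)\<close> with \<open>c = s\<^sup>2 / (2 \<sigma>)\<close>. Comparing the coefficients
  of \<open>a\<^sup>m\<close> and then those of \<open>b\<^sup>n\<close> gives the inner products.
\<close>

lemma gauss_poly_orthogonal:
  fixes \<sigma> s q :: real
  assumes \<sigma>: "\<sigma> > 0" and q: "q = - s\<^sup>2 / (4 * \<sigma>)"
  shows "integrable (gauss \<sigma>) (\<lambda>x. gauss_poly s q m x * gauss_poly s q n x)"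
    and "(LINT x|gauss \<sigma>. gauss_poly s q m x * gauss_poly s q n x)
      = (if m = n then (s\<^sup>2 / (2 * \<sigma>)) ^ n / fact n else 0)"
proof -
  let ?h = "gauss_poly s q"
  define K where "K a x = exp (s * x * a + q * a\<^sup>2)" for a x :: real
  define E where "E r x = exp (\<bar>s\<bar> * \<bar>x\<bar> * r + \<bar>q\<bar> * r\<^sup>2)" for r x :: real
  have [measurable]: "K a \<in> borel_measurable borel" for a
    unfolding K_def [abs_def] by measurable
  have K: "(\<lambda>n. ?h n x * a ^ n) sums K a x" for a x
    using gauss_poly_sums[of s q x a] by (simp add: K_def)
  have E: "(\<Sum>n<N. \<bar>?h n x * a ^ n\<bar>) \<le> E \<bar>a\<bar> x" for N a x
    using sum_abs_gauss_poly_le[of "\<bar>a\<bar>" s q x N] by (simp add: E_def abs_mult power_abs)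
  have EE: "integrable (gauss \<sigma>) (\<lambda>x. E r x * E r' x)" for r r'
  proof -
    have "E r x * E r' x = exp (\<bar>q\<bar> * r\<^sup>2 + \<bar>q\<bar> * r'\<^sup>2) * exp ((\<bar>s\<bar> * (r + r')) * \<bar>x\<bar>)" for x
      by (simp add: E_def exp_add[symmetric] algebra_simps)
    then show ?thesis
      using gauss_real_exp_abs[OF \<sigma>, of "\<bar>s\<bar> * (r + r')"] by simp
  qed
  have E0: "E r x \<ge> 0" for r x by (simp add: E_def)
  have K_le: "\<bar>K a x\<bar> \<le> E \<bar>a\<bar> x" for a x
  proof -
    have "s * x * a \<le> \<bar>s * x * a\<bar>" "q * a\<^sup>2 \<le> \<bar>q * a\<^sup>2\<bar>" by simp_all
    then show ?thesis by (auto simp: K_def E_def abs_mult intro: add_mono)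
  qed
  have h_le: "\<bar>?h n x\<bar> \<le> E 1 x" for n x
    using member_le_sum[of n "{..<Suc n}" "\<lambda>j. \<bar>?h j x\<bar>"] E[where a = 1 and N = "Suc n" and x = x]
    by (simp del: sum.lessThan_Suc)
  \<comment> \<open>The coefficients are extracted one variable at a time: \<open>J b m\<close> is the coefficient of \<open>a\<^sup>m\<close>, and
    \<open>I m n\<close> the coefficient of \<open>b\<^sup>n\<close> in \<open>J b m\<close>.\<close>
  define I where "I m n = (LINT x|gauss \<sigma>. ?h m x * ?h n x)" for m n
  define J where "J b m = (LINT x|gauss \<sigma>. ?h m x * K b x)" for b m
  define c where "c = s\<^sup>2 / (2 * \<sigma>)"
  have KK: "(LINT x|gauss \<sigma>. K a x * K b x) = exp (c * a * b)" for a b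
  proof -
    have "K a x * K b x = exp (q * a\<^sup>2 + q * b\<^sup>2) * exp ((s * (a + b)) * x)" for x
      by (simp add: K_def exp_add[symmetric] algebra_simps)
    then have "(LINT x|gauss \<sigma>. K a x * K b x) = exp (q * a\<^sup>2 + q * b\<^sup>2) * exp ((s * (a + b))\<^sup>2 / (4 * \<sigma>))"
      using gauss_real_exp(2)[OF \<sigma>, of "s * (a + b)"] by simp
    also have "\<dots> = exp (c * a * b)"
      using \<sigma> by (simp add: exp_add[symmetric] q c_def field_simps power2_eq_square)
    finally show ?thesis .
  qed
  have exp_sums: "(\<lambda>m. (c * b) ^ m / fact m * a ^ m) sums exp (c * a * b)" for a b
    using exp_converges[of "c * a * b"] by (simp add: power_mult_distrib divide_inverse mult_ac)
  have J_sums: "(\<lambda>m. J b m * a ^ m) sums exp (c * a * b)" for a b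
  proof -
    have "(\<lambda>m. LINT x|gauss \<sigma>. (?h m x * a ^ m) * K b x) sums (LINT x|gauss \<sigma>. K a x * K b x)"
    proof (rule integral_sums_dominated(3)[where g = "\<lambda>x. E \<bar>a\<bar> x * E \<bar>b\<bar> x"])
      fix x N
      have "(\<Sum>i<N. norm (?h i x * a ^ i * K b x)) = (\<Sum>i<N. \<bar>?h i x * a ^ i\<bar>) * \<bar>K b x\<bar>"
        by (simp add: sum_distrib_right abs_mult)
      also have "\<dots> \<le> E \<bar>a\<bar> x * E \<bar>b\<bar> x"
        by (intro mult_mono E K_le E0) simp
      finally show "(\<Sum>i<N. norm (?h i x * a ^ i * K b x)) \<le> E \<bar>a\<bar> x * E \<bar>b\<bar> x" .
    qed (auto intro: EE sums_mult2 K)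
    also have "(\<lambda>m. LINT x|gauss \<sigma>. (?h m x * a ^ m) * K b x) = (\<lambda>m. J b m * a ^ m)"
      by (simp add: J_def mult_ac flip: integral_mult_right_zero)
    finally show ?thesis by (simp add: KK)
  qed
  have J: "J b m = (c * b) ^ m / fact m" for b m
    using J_sums exp_sums by (intro powser_unique_real[of 1 "J b" "\<lambda>a. exp (c * a * b)"]) auto
  have hh: "integrable (gauss \<sigma>) (\<lambda>x. ?h m x * ?h n x)" for m n
    by (rule Bochner_Integration.integrable_bound[OF EE[of 1 1]])
       (auto simp: abs_mult E0 intro!: mult_mono h_le)
  have I_sums: "(\<lambda>n. I m n * b ^ n) sums J b m" for b m
  proof -
    have "(\<lambda>n. LINT x|gauss \<sigma>. ?h m x * (?h n x * b ^ n)) sums (LINT x|gauss \<sigma>. ?h m x * K b x)"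
    proof (rule integral_sums_dominated(3)[where g = "\<lambda>x. E 1 x * E \<bar>b\<bar> x"])
      fix x N
      have "(\<Sum>i<N. norm (?h m x * (?h i x * b ^ i))) = \<bar>?h m x\<bar> * (\<Sum>i<N. \<bar>?h i x * b ^ i\<bar>)"
        by (simp add: sum_distrib_left abs_mult)
      also have "\<dots> \<le> E 1 x * E \<bar>b\<bar> x"
        by (intro mult_mono E h_le E0 sum_nonneg) simp
      finally show "(\<Sum>i<N. norm (?h m x * (?h i x * b ^ i))) \<le> E 1 x * E \<bar>b\<bar> x" .
    qed (auto intro: EE sums_mult K)
    also have "(\<lambda>n. LINT x|gauss \<sigma>. ?h m x * (?h n x * b ^ n)) = (\<lambda>n. I m n * b ^ n)"
      by (simp add: I_def mult_ac flip: integral_mult_right_zero)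
    finally show ?thesis by (simp add: J_def)
  qed
  have "(\<lambda>n. (if m = n then c ^ m / fact m else 0) * b ^ n) sums J b m" for b
    using sums_single[of m "\<lambda>n. c ^ m / fact m * b ^ n"]
    by (simp add: J power_mult_distrib if_distrib[of "\<lambda>x. x * _"] eq_commute[of m] cong: if_cong)
  then have "I m n = (if m = n then c ^ m / fact m else 0)"
    using I_sums by (intro powser_unique_real[of 1 "I m" "\<lambda>b. J b m" "\<lambda>n. if m = n then c ^ m / fact m else 0"]) auto
  then show "(LINT x|gauss \<sigma>. ?h m x * ?h n x) = (if m = n then (s\<^sup>2 / (2 * \<sigma>)) ^ n / fact n else 0)"
    by (simp add: I_def c_def)
  show "integrable (gauss \<sigma>) (\<lambda>x. ?h m x * ?h n x)"
    by (rule hh)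
qed

section \<open>Entire functions and the Gaussian measure of the plane\<close>

lemma distr_gauss_rotate:
  assumes c: "cmod c = 1" and t: "t > 0"
  shows "distr (gauss t) borel (\<lambda>z. c * z) = gauss t"
proof (rule measure_eqI)
  fix A assume "A \<in> sets (distr (gauss t) borel (\<lambda>z. c * z))"
  then have [measurable]: "A \<in> sets borel" by simp
  define g where "g z = ennreal (t / pi * exp (- t * (cmod z)\<^sup>2)) * indicator A z" for z :: complex
  have [measurable]: "g \<in> borel_measurable borel"
    unfolding g_def by measurable
  have "emeasure (distr (gauss t) borel (\<lambda>z. c * z)) A = (\<integral>\<^sup>+z. indicator A (c * z) \<partial>gauss t)"
    by (simp add: nn_integral_distr flip: nn_integral_indicator)
  also have "\<dots> = (\<integral>\<^sup>+z. g (c * z) \<partial>lborel)"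
    using t c unfolding gauss_def
    by (subst nn_integral_density) (auto intro!: nn_integral_cong simp: g_def norm_mult)
  also have "\<dots> = (\<integral>\<^sup>+z. g z \<partial>lborel)"
    by (rule nn_integral_lborel_rotate) (use c in auto)
  also have "\<dots> = emeasure (gauss t) A"
    using t by (simp add: gauss_def emeasure_density g_def)
  finally show "emeasure (distr (gauss t) borel (\<lambda>z. c * z)) A = emeasure (gauss t) A" .
qed simp

text \<open>The rotation by \<open>\<pi> / (m - n)\<close> changes the sign of the integrand and preserves the measure and the disc.\<close>

lemma disc_monomials_orthogonal:
  fixes R t :: real
  assumes t: "t > 0" and "m \<noteq> n"
  shows "(LINT z|gauss t. indicator (cball 0 R) z *\<^sub>R (z ^ m * cnj z ^ n)) = 0"
proof -
  obtain c where c: "cmod c = 1" "c ^ m * cnj c ^ n = -1"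
  proof (cases "m > n")
    case True
    define c where "c = cis (pi / real (m - n))"
    have "c * cnj c = 1"
      by (simp add: c_def cis_cnj cis_mult)
    then have "c ^ n * cnj c ^ n = 1"
      by (simp flip: power_mult_distrib)
    moreover have "c ^ m = c ^ (m - n) * c ^ n"
      using True by (simp flip: power_add)
    moreover have "c ^ (m - n) = -1"
      using True unfolding c_def Complex.DeMoivre by (simp del: of_nat_diff)
    ultimately have "c ^ m * cnj c ^ n = -1" by simp
    then show thesis
      using that[of c] by (simp add: c_def)
  next
    case False
    then have "m < n" using assms by simp
    define c where "c = cis (pi / real (n - m))"
    have "cnj c * c = 1"
      by (simp add: c_def cis_cnj cis_mult)
    then have "cnj c ^ m * c ^ m = 1"
      by (simp flip: power_mult_distrib)
    moreover have "cnj c ^ n = cnj c ^ (n - m) * cnj c ^ m"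
      using \<open>m < n\<close> by (simp flip: power_add)
    moreover have "cnj c ^ (n - m) = -1"
      using \<open>m < n\<close> unfolding c_def complex_cnj_power[symmetric] Complex.DeMoivre by (simp del: of_nat_diff)
    ultimately have "c ^ m * cnj c ^ n = -1" by (simp add: mult_ac)
    then show thesis
      using that[of c] by (simp add: c_def)
  qed
  define G where "G z = indicator (cball 0 R) z *\<^sub>R (z ^ m * cnj z ^ n)" for z :: complex
  have [measurable]: "G \<in> borel_measurable borel"
    unfolding G_def [abs_def] by (intro borel_measurable_scaleR borel_measurable_indicator) (simp, measurable)
  have "G (c * z) = - G z" for z
  proof -
    have "(c * z) ^ m * cnj (c * z) ^ n = (c ^ m * cnj c ^ n) * (z ^ m * cnj z ^ n)"
      by (simp add: power_mult_distrib mult_ac)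
    then show ?thesis
      using c by (simp add: G_def indicator_def norm_mult)
  qed
  then have "(LINT z|gauss t. G z) = - (LINT z|gauss t. G z)"
    using integral_distr[of "\<lambda>z. c * z" "gauss t" borel G] distr_gauss_rotate[OF c(1) t] by simp
  then show ?thesis
    by (simp add: G_def [abs_def])
qed

text \<open>
  The moments of even order are read off from their generating function
  \<open>\<integral> exp (b |z|\<^sup>2) = t / (t - b)\<close>, a geometric series in \<open>b / t\<close>.
\<close>

lemma gauss_complex_moment:
  assumes t: "t > 0"
  shows "(\<integral>\<^sup>+z. ennreal ((cmod z) ^ (2 * n)) \<partial>gauss t) = ennreal (fact n / t ^ n)"
proof -
  define e where "e b z = exp (b * (cmod z)\<^sup>2)" for b :: real and z :: complex
  have [measurable]: "e b \<in> borel_measurable borel" for b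
    unfolding e_def [abs_def] by measurable
  have nn: "(\<integral>\<^sup>+z. ennreal (e b z) \<partial>gauss t) = ennreal (t / (t - b))" if "b < t" for b
  proof -
    have "(\<integral>\<^sup>+z. ennreal (e b z) \<partial>gauss t) = (\<integral>\<^sup>+z. ennreal (t / pi) * ennreal (exp (- (t - b) * (cmod (z - 0))\<^sup>2)) \<partial>lborel)"
      using t unfolding gauss_def
      by (subst nn_integral_density)
         (auto simp: e_def ennreal_mult'[symmetric] exp_add[symmetric] algebra_simps intro!: nn_integral_cong)
    also have "\<dots> = ennreal (t / pi) * ennreal (pi / (t - b))"
      using nn_integral_gaussian_complex[of "t - b" 0] that by (simp add: nn_integral_cmult)
    also have "\<dots> = ennreal (t / (t - b))"
      using t that by (simp add: ennreal_mult'[symmetric])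
    finally show ?thesis .
  qed
  have e: "integrable (gauss t) (e b)" "(LINT z|gauss t. e b z) = t / (t - b)" if "b < t" for b
  proof -
    show int: "integrable (gauss t) (e b)"
      using nn[OF that] by (intro integrableI_nonneg) (auto simp: e_def)
    show "(LINT z|gauss t. e b z) = t / (t - b)"
      using nn[OF that] t that nn_integral_eq_integral[OF int]
      by (simp add: e_def[abs_def] Bochner_Integration.integral_nonneg)
  qed
  have monomial: "(b * (cmod z)\<^sup>2) ^ n / fact n = b ^ n / fact n * (cmod z) ^ (2 * n)" for b z n
    by (simp add: power_mult_distrib power_mult)
  have bound: "(\<Sum>i<N. norm (b ^ i / fact i * (cmod z) ^ (2 * i))) \<le> e \<bar>b\<bar> z" for b z N
  proof -
    have sums: "(\<lambda>i. (\<bar>b\<bar> * (cmod z)\<^sup>2) ^ i / fact i) sums e \<bar>b\<bar> z"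
      using exp_converges[of "\<bar>b\<bar> * (cmod z)\<^sup>2"] by (simp add: e_def divide_inverse mult.commute)
    have "(\<Sum>i<N. norm (b ^ i / fact i * (cmod z) ^ (2 * i))) = (\<Sum>i<N. (\<bar>b\<bar> * (cmod z)\<^sup>2) ^ i / fact i)"
      by (simp add: monomial abs_mult power_abs)
    also have "\<dots> \<le> (\<Sum>i. (\<bar>b\<bar> * (cmod z)\<^sup>2) ^ i / fact i)"
      using sums by (intro sum_le_suminf) (auto simp: sums_iff)
    finally show ?thesis
      using sums by (simp add: sums_iff)
  qed
  have series: "(\<lambda>i. b ^ i / fact i * (cmod z) ^ (2 * i)) sums e b z" for b z
    using exp_converges[of "b * (cmod z)\<^sup>2"] unfolding monomial[symmetric]
    by (simp add: e_def divide_inverse mult.commute)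
  define M where "M n = (LINT z|gauss t. (cmod z) ^ (2 * n))" for n
  have M: "integrable (gauss t) (\<lambda>z. b ^ i / fact i * (cmod z) ^ (2 * i))"
    "(\<lambda>i. LINT z|gauss t. b ^ i / fact i * (cmod z) ^ (2 * i)) sums (t / (t - b))" if "\<bar>b\<bar> < t" for b i
    using integral_sums_dominated[OF _ series e(1)[OF that] bound] e(2)[of b] that by auto
  have int: "integrable (gauss t) (\<lambda>z. (cmod z) ^ (2 * n))"
  proof -
    have "integrable (gauss t) (\<lambda>z. (fact n / (t / 2) ^ n) * ((t / 2) ^ n / fact n * cmod z ^ (2 * n)))"
      using t by (intro integrable_mult_right M) auto
    then show ?thesis using t by simp
  qed
  have "M n / fact n = 1 / t ^ n"
  proof (rule powser_unique_real[OF t])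
    fix b :: real assume b: "\<bar>b\<bar> < t"
    show "(\<lambda>n. M n / fact n * b ^ n) sums (t / (t - b))"
      using M(2)[OF b] by (simp add: M_def mult_ac)
    have "(\<lambda>n. (b / t) ^ n) sums (1 / (1 - b / t))"
      using b t by (intro geometric_sums) auto
    then show "(\<lambda>n. 1 / t ^ n * b ^ n) sums (t / (t - b))"
      using t b by (simp add: power_divide field_simps)
  qed
  then have "M n = fact n / t ^ n"
    by (simp add: field_simps)
  then show ?thesis
    using int by (simp add: nn_integral_eq_integral M_def)
qed

lemma pred_cball [measurable]: "Measurable.pred borel (\<lambda>z. z \<in> cball (a::'a::euclidean_space) r)"
  using borel_closed[OF closed_cball, of a r] by (simp add: pred_def)

text \<open>On a disc the partial sums of the Taylor series are uniformly bounded, and for them the identity is the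
  orthogonality of the monomials.\<close>

lemma nn_integral_disc_entire:
  fixes R t :: real
  assumes t: "t > 0" and F: "\<And>z. (\<lambda>n. a n * z ^ n) sums F z"
  shows "(\<integral>\<^sup>+z. indicator (cball 0 R) z * ennreal ((cmod (F z))\<^sup>2) \<partial>gauss t)
    = (\<Sum>n. \<integral>\<^sup>+z. indicator (cball 0 R) z * ennreal ((cmod (a n))\<^sup>2 * cmod z ^ (2 * n)) \<partial>gauss t)"
proof -
  interpret prob_space "gauss t :: complex measure"
    using t by (rule prob_space_gauss_complex)
  define ind :: "complex \<Rightarrow> real" where "ind = indicator (cball 0 R)"
  have ind [measurable]: "ind \<in> borel_measurable borel"
    unfolding ind_def by (rule borel_measurable_indicator) simp
  define S where "S N z = (\<Sum>n<N. a n * z ^ n)" for N z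
  have [measurable]: "S N \<in> borel_measurable borel" for N
    unfolding S_def [abs_def] by measurable
  have S_F: "(\<lambda>N. S N z) \<longlonglongrightarrow> F z" for z
    using F[of z] by (simp add: sums_def S_def)
  have [measurable]: "F \<in> borel_measurable borel"
    by (rule borel_measurable_LIMSEQ_metric[OF _ S_F]) measurable
  \<comment> \<open>a bound for all partial sums on the disc\<close>
  define A where "A = (\<Sum>n. cmod (a n) * \<bar>R\<bar> ^ n)"
  have "summable (\<lambda>n. norm (a n * of_real \<bar>R\<bar> ^ n))"
    by (rule powser_insidea[OF sums_summable[OF F[of "of_real (\<bar>R\<bar> + 1)"]]]) simp
  then have sumA: "summable (\<lambda>n. cmod (a n) * \<bar>R\<bar> ^ n)"
    by (simp add: norm_mult norm_power)
  have S_le: "cmod (S N z) \<le> A" if "cmod z \<le> R" for N z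
  proof -
    have "cmod (S N z) \<le> (\<Sum>n<N. cmod (a n) * \<bar>R\<bar> ^ n)"
      unfolding S_def using that
      by (intro order_trans[OF norm_sum] sum_mono) (auto simp: norm_mult norm_power intro!: mult_left_mono power_mono)
    also have "\<dots> \<le> A"
      unfolding A_def by (intro sum_le_suminf sumA) auto
    finally show ?thesis .
  qed
  have bound: "AE z in gauss t. norm (ind z * (cmod (S N z))\<^sup>2) \<le> A\<^sup>2" for N
    by (auto simp: ind_def indicator_def intro!: power_mono S_le)
  have lim: "AE z in gauss t. (\<lambda>N. ind z * (cmod (S N z))\<^sup>2) \<longlonglongrightarrow> ind z * (cmod (F z))\<^sup>2"
    by (intro AE_I2 tendsto_intros S_F)
  have int_F: "integrable (gauss t) (\<lambda>z. ind z * (cmod (F z))\<^sup>2)"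
    by (rule integrable_dominated_convergence[OF _ _ _ lim bound]) auto
  have "(\<lambda>N. LINT z|gauss t. ind z * (cmod (S N z))\<^sup>2) \<longlonglongrightarrow> (LINT z|gauss t. ind z * (cmod (F z))\<^sup>2)"
    by (rule integral_dominated_convergence[OF _ _ _ lim bound]) auto
  moreover define \<mu> where "\<mu> n = (LINT z|gauss t. ind z * cmod z ^ (2 * n))" for n
  have mono_int: "integrable (gauss t) (\<lambda>z. ind z *\<^sub>R (z ^ m * cnj z ^ n))" for m n
    by (rule integrable_const_bound[where B = "\<bar>R\<bar> ^ (m + n)"])
       (auto simp: ind_def indicator_def norm_mult norm_power power_add intro!: mult_mono power_mono)
  have mu_int: "integrable (gauss t) (\<lambda>z. ind z * cmod z ^ (2 * n))" for n
    by (rule integrable_const_bound[where B = "\<bar>R\<bar> ^ (2 * n)"])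
       (auto simp: ind_def indicator_def intro!: power_mono)
  have "(LINT z|gauss t. ind z * (cmod (S N z))\<^sup>2) = (\<Sum>n<N. (cmod (a n))\<^sup>2 * \<mu> n)" for N
  proof -
    have "complex_of_real (ind z * (cmod (S N z))\<^sup>2)
        = (\<Sum>m<N. \<Sum>n<N. (a m * cnj (a n)) * (ind z *\<^sub>R (z ^ m * cnj z ^ n)))" for z
      unfolding of_real_mult complex_norm_square S_def cnj_sum sum_product scaleR_conv_of_real
      by (simp add: sum_distrib_left mult_ac)
    then have "complex_of_real (LINT z|gauss t. ind z * (cmod (S N z))\<^sup>2)
        = (LINT z|gauss t. (\<Sum>m<N. \<Sum>n<N. (a m * cnj (a n)) * (ind z *\<^sub>R (z ^ m * cnj z ^ n))))"
      by (simp only: integral_complex_of_real[symmetric])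
    also have "\<dots> = (\<Sum>m<N. \<Sum>n<N. (a m * cnj (a n)) * (LINT z|gauss t. ind z *\<^sub>R (z ^ m * cnj z ^ n)))"
      by (subst Bochner_Integration.integral_sum Bochner_Integration.integral_sum
            integral_mult_right_zero; (intro Bochner_Integration.integrable_sum integrable_mult_right mono_int)?)+
         simp
    also have "\<dots> = (\<Sum>m<N. \<Sum>n<N. if m = n then (a m * cnj (a n)) * of_real (\<mu> n) else 0)"
    proof (intro sum.cong refl)
      fix m n
      show "(a m * cnj (a n)) * (LINT z|gauss t. ind z *\<^sub>R (z ^ m * cnj z ^ n))
          = (if m = n then (a m * cnj (a n)) * of_real (\<mu> n) else 0)"
      proof (cases "m = n")
        case True
        have "z ^ n * cnj z ^ n = of_real (cmod z ^ (2 * n))" for z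
          by (simp only: power_mult power_mult_distrib[symmetric] complex_norm_square[symmetric] of_real_power)
        then have "ind z *\<^sub>R (z ^ n * cnj z ^ n) = complex_of_real (ind z * cmod z ^ (2 * n))" for z
          by (simp only: scaleR_conv_of_real of_real_mult)
        then show ?thesis
          using True by (simp only: \<mu>_def integral_complex_of_real) simp
      qed (use disc_monomials_orthogonal[OF t, of m n R] in \<open>simp add: ind_def\<close>)
    qed
    also have "\<dots> = of_real (\<Sum>n<N. (cmod (a n))\<^sup>2 * \<mu> n)"
      by (simp add: complex_norm_square del: of_real_power)
    finally show ?thesis
      using of_real_eq_iff by blast
  qed
  ultimately have sums: "(\<lambda>n. (cmod (a n))\<^sup>2 * \<mu> n) sums (LINT z|gauss t. ind z * (cmod (F z))\<^sup>2)"
    by (simp add: sums_def)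
  have \<mu>0: "\<mu> n \<ge> 0" for n
    unfolding \<mu>_def by (intro Bochner_Integration.integral_nonneg) (simp add: ind_def)
  have ind_e: "indicator (cball 0 R) z * ennreal x = ennreal (ind z * x)" for z x
    by (simp add: ind_def indicator_def)
  have "(\<integral>\<^sup>+z. indicator (cball 0 R) z * ennreal ((cmod (F z))\<^sup>2) \<partial>gauss t)
      = ennreal (LINT z|gauss t. ind z * (cmod (F z))\<^sup>2)"
    unfolding ind_e by (rule nn_integral_eq_integral[OF int_F]) (simp add: ind_def)
  also have "\<dots> = (\<Sum>n. ennreal ((cmod (a n))\<^sup>2 * \<mu> n))"
    using sums \<mu>0 by (subst suminf_ennreal2) (auto simp: sums_iff)
  also have "(\<lambda>n. ennreal ((cmod (a n))\<^sup>2 * \<mu> n))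
      = (\<lambda>n. \<integral>\<^sup>+z. indicator (cball 0 R) z * ennreal ((cmod (a n))\<^sup>2 * cmod z ^ (2 * n)) \<partial>gauss t)"
  proof
    fix n
    have "(\<integral>\<^sup>+z. ennreal (ind z * ((cmod (a n))\<^sup>2 * cmod z ^ (2 * n))) \<partial>gauss t)
        = ennreal (LINT z|gauss t. (cmod (a n))\<^sup>2 * (ind z * cmod z ^ (2 * n)))"
      unfolding mult.left_commute[of "ind _"]
      by (rule nn_integral_eq_integral[OF integrable_mult_right[OF mu_int]]) (simp add: ind_def)
    then show "ennreal ((cmod (a n))\<^sup>2 * \<mu> n)
        = (\<integral>\<^sup>+z. indicator (cball 0 R) z * ennreal ((cmod (a n))\<^sup>2 * cmod z ^ (2 * n)) \<partial>gauss t)"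
      by (simp add: ind_e \<mu>_def)
  qed
  finally show ?thesis .
qed

text \<open>
  Monotone convergence over growing discs. The identity holds in the extended reals, so it decides
  from the Taylor coefficients whether an entire function is square integrable.
\<close>

lemma nn_integral_gauss_entire:
  assumes t: "t > 0" and F: "\<And>z. (\<lambda>n. a n * z ^ n) sums F z"
  shows "(\<integral>\<^sup>+z. ennreal ((cmod (F z))\<^sup>2) \<partial>gauss t) = (\<Sum>n. ennreal ((cmod (a n))\<^sup>2 * fact n / t ^ n))"
proof -
  have [measurable]: "F \<in> borel_measurable borel"
    by (rule borel_measurable_LIMSEQ_metric[of "\<lambda>N z. \<Sum>n<N. a n * z ^ n"])
       (use F in \<open>auto simp: sums_def\<close>)
  have exhaust: "(\<integral>\<^sup>+z. g z \<partial>gauss t) = (SUP k. \<integral>\<^sup>+z. indicator (cball 0 (real k)) z * g z \<partial>gauss t)"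
    if [measurable]: "g \<in> borel_measurable borel" for g :: "complex \<Rightarrow> ennreal"
  proof -
    have sup: "(SUP k. indicator (cball 0 (real k)) z * g z) = g z" for z
    proof (rule antisym)
      show "(SUP k. indicator (cball 0 (real k)) z * g z) \<le> g z"
        by (intro SUP_least) (simp add: indicator_def)
      obtain k where "cmod z \<le> real k"
        using real_arch_simple by blast
      then show "g z \<le> (SUP k. indicator (cball 0 (real k)) z * g z)"
        by (intro SUP_upper2[of k]) auto
    qed
    have "(\<integral>\<^sup>+z. (SUP k. indicator (cball 0 (real k)) z * g z) \<partial>gauss t)
        = (SUP k. \<integral>\<^sup>+z. indicator (cball 0 (real k)) z * g z \<partial>gauss t)"
      by (rule nn_integral_monotone_convergence_SUP)
         (auto simp: incseq_def le_fun_def indicator_def)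
    then show ?thesis
      by (simp only: sup)
  qed
  have disc: "(\<integral>\<^sup>+z. indicator (cball 0 R) z * ennreal ((cmod (F z))\<^sup>2) \<partial>gauss t)
      = (\<integral>\<^sup>+z. indicator (cball 0 R) z * (\<Sum>n. ennreal ((cmod (a n))\<^sup>2 * cmod z ^ (2 * n))) \<partial>gauss t)" for R
    unfolding nn_integral_disc_entire[OF t F]
    by (subst nn_integral_suminf[symmetric]) (auto simp: ennreal_suminf_cmult)
  have "(\<integral>\<^sup>+z. ennreal ((cmod (F z))\<^sup>2) \<partial>gauss t)
      = (SUP k. \<integral>\<^sup>+z. indicator (cball 0 (real k)) z * ennreal ((cmod (F z))\<^sup>2) \<partial>gauss t)"
    by (rule exhaust) measurable
  also have "\<dots> = (SUP k. \<integral>\<^sup>+z. indicator (cball 0 (real k)) z *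
      (\<Sum>n. ennreal ((cmod (a n))\<^sup>2 * cmod z ^ (2 * n))) \<partial>gauss t)"
    by (simp only: disc)
  also have "\<dots> = (\<integral>\<^sup>+z. (\<Sum>n. ennreal ((cmod (a n))\<^sup>2 * cmod z ^ (2 * n))) \<partial>gauss t)"
    by (rule exhaust[symmetric]) measurable
  also have "\<dots> = (\<Sum>n. \<integral>\<^sup>+z. ennreal ((cmod (a n))\<^sup>2) * ennreal (cmod z ^ (2 * n)) \<partial>gauss t)"
    by (subst nn_integral_suminf) (auto simp: ennreal_mult)
  also have "\<dots> = (\<Sum>n. ennreal ((cmod (a n))\<^sup>2) * ennreal (fact n / t ^ n))"
  proof (rule suminf_cong)
    fix n
    have "(\<integral>\<^sup>+z. ennreal ((cmod (a n))\<^sup>2) * ennreal (cmod z ^ (2 * n)) \<partial>gauss t)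
        = ennreal ((cmod (a n))\<^sup>2) * (\<integral>\<^sup>+z. ennreal (cmod z ^ (2 * n)) \<partial>gauss t)"
      by (rule nn_integral_cmult) measurable
    then show "(\<integral>\<^sup>+z. ennreal ((cmod (a n))\<^sup>2) * ennreal (cmod z ^ (2 * n)) \<partial>gauss t)
        = ennreal ((cmod (a n))\<^sup>2) * ennreal (fact n / t ^ n)"
      by (simp only: gauss_complex_moment[OF t])
  qed
  also have "\<dots> = (\<Sum>n. ennreal ((cmod (a n))\<^sup>2 * fact n / t ^ n))"
    using t by (simp add: ennreal_mult[symmetric])
  finally show ?thesis .
qed

section \<open>The Segal--Bargmann transform in one complex variable\<close>

locale segal_bargmann =
  fixes \<sigma> \<nu> :: real
  assumes \<sigma>: "\<sigma> > 0" and \<nu>: "\<nu> > 0"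
begin

text \<open>
  With \<open>q = - s\<^sup>2 / (4 * \<sigma>)\<close>, as orthogonality of \<^const>\<open>gauss_poly\<close> demands, \<open>weight n\<close> is the squared norm
  of \<open>hermite n\<close>. The kernel is \<open>exp (- \<sigma> (x - sqrt (\<nu> / (4 \<sigma>)) z)\<^sup>2)\<close> without the factor
  \<open>exp (- \<sigma> x\<^sup>2)\<close>, which the Gaussian measure supplies.
\<close>

definition s :: real where "s = sqrt (\<sigma> * \<nu>)"
definition q :: real where "q = - \<nu> / 4"
definition weight :: "nat \<Rightarrow> real" where "weight n = (\<nu> / 2) ^ n / fact n"
definition hermite :: "nat \<Rightarrow> real \<Rightarrow> complex" where "hermite n x = of_real (gauss_poly s q n x)"
definition kernel :: "complex \<Rightarrow> real \<Rightarrow> complex" where "kernel z x = exp (of_real (s * x) * z + of_real q * z\<^sup>2)"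
definition transform :: "(real \<Rightarrow> complex) \<Rightarrow> complex \<Rightarrow> complex" where "transform \<phi> z = (LINT x|gauss \<sigma>. kernel z x * \<phi> x)"

lemma s: "s\<^sup>2 = \<sigma> * \<nu>" "s > 0"
  using \<sigma> \<nu> by (auto simp: s_def)

lemma weight_pos: "weight n > 0"
  using \<nu> by (simp add: weight_def)

lemma hermite_measurable [measurable]: "hermite n \<in> borel_measurable borel"
  unfolding hermite_def [abs_def] by measurable

lemma kernel_measurable [measurable]: "kernel z \<in> borel_measurable borel"
  unfolding kernel_def [abs_def] by measurable

lemma kernel_sums: "(\<lambda>n. hermite n x * z ^ n) sums kernel z x"
  unfolding hermite_def kernel_def by (rule gauss_poly_sums)

sublocale orthonormal_sequence "gauss \<sigma>" "\<lambda>n x. hermite n x / of_real (sqrt (weight n))"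
proof
  have q: "q = - s\<^sup>2 / (4 * \<sigma>)"
    using \<sigma> by (simp add: q_def s)
  note orth = gauss_poly_orthogonal[OF \<sigma> q]
  have weight: "(s\<^sup>2 / (2 * \<sigma>)) ^ n / fact n = weight n" for n
    using \<sigma> by (simp add: weight_def s)
  show "sq_integrable (gauss \<sigma>) (\<lambda>x. hermite n x / of_real (sqrt (weight n)))" for n
    using orth(1)[of n n] weight_pos[of n]
    by (simp add: sq_integrable_def hermite_def norm_divide power_divide power2_eq_square[symmetric] abs_mult[symmetric])
  show "(LINT x|gauss \<sigma>. hermite m x / of_real (sqrt (weight m)) * cnj (hermite n x / of_real (sqrt (weight n)))) = (if m = n then 1 else 0)"
    for m n
  proof -
    have "hermite m x / of_real (sqrt (weight m)) * cnj (hermite n x / of_real (sqrt (weight n)))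
        = of_real (gauss_poly s q m x * gauss_poly s q n x / (sqrt (weight m) * sqrt (weight n)))" for x
      by (simp add: hermite_def)
    then have eq: "(LINT x|gauss \<sigma>. hermite m x / of_real (sqrt (weight m)) * cnj (hermite n x / of_real (sqrt (weight n))))
        = of_real ((LINT x|gauss \<sigma>. gauss_poly s q m x * gauss_poly s q n x) / (sqrt (weight m) * sqrt (weight n)))"
      by (simp only: integral_complex_of_real integral_divide_zero)
    show ?thesis
      unfolding eq orth(2) weight using weight_pos[of n] by (simp flip: of_real_mult)
  qed
qed

lemma exp_abs_sq_integrable: "sq_integrable (gauss \<sigma>) (\<lambda>x. of_real (exp (c * \<bar>x\<bar> + d)))"
proof -
  have "(cmod (of_real (exp (c * \<bar>x\<bar> + d))))\<^sup>2 = exp (2 * d) * exp ((2 * c) * \<bar>x\<bar>)" for x :: real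
    by (simp add: power2_eq_square exp_add[symmetric] algebra_simps)
  then show ?thesis
    using gauss_real_exp_abs[OF \<sigma>, of "2 * c"] by (simp add: sq_integrable_def)
qed

text \<open>
  Expanding the kernel and integrating termwise shows that the transform is an everywhere convergent power series
  whose coefficients are those of \<open>\<phi>\<close> for the orthonormal sequence, multiplied by the norms of the polynomials.
\<close>

lemma transform_series:
  assumes \<phi>: "sq_integrable (gauss \<sigma>) \<phi>"
  shows "integrable (gauss \<sigma>) (\<lambda>x. kernel z x * \<phi> x)"
    and "(\<lambda>n. of_real (sqrt (weight n)) * coeff \<phi> n * z ^ n) sums transform \<phi> z"
proof -
  note [measurable] = sq_integrable_measurable[OF \<phi>]
  define E where "E x = exp ((\<bar>s\<bar> * cmod z) * \<bar>x\<bar> + \<bar>q\<bar> * (cmod z)\<^sup>2)" for x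
  have "integrable (gauss \<sigma>) (\<lambda>x. cmod (of_real (E x) * \<phi> x))"
    unfolding E_def by (intro integrable_norm integrable_mult_sq_integrable exp_abs_sq_integrable \<phi>)
  then have g: "integrable (gauss \<sigma>) (\<lambda>x. E x * cmod (\<phi> x))"
    by (simp add: norm_mult E_def)
  have bound: "(\<Sum>i<N. cmod (hermite i x * z ^ i * \<phi> x)) \<le> E x * cmod (\<phi> x)" for x N
  proof -
    have "(\<Sum>i<N. cmod (hermite i x * z ^ i * \<phi> x)) = (\<Sum>i<N. \<bar>gauss_poly s q i x\<bar> * cmod z ^ i) * cmod (\<phi> x)"
      by (simp add: hermite_def norm_mult norm_power sum_distrib_right)
    also have "\<dots> \<le> E x * cmod (\<phi> x)"
      using sum_abs_gauss_poly_le[of "cmod z" s q x N] by (intro mult_right_mono) (simp_all add: E_def mult_ac)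
    finally show ?thesis .
  qed
  have sums: "(\<lambda>i. hermite i x * z ^ i * \<phi> x) sums (kernel z x * \<phi> x)" for x
    by (intro sums_mult2 kernel_sums)
  show "integrable (gauss \<sigma>) (\<lambda>x. kernel z x * \<phi> x)"
    by (rule integral_sums_dominated(2)[OF _ sums g bound]) measurable
  have "(\<lambda>i. LINT x|gauss \<sigma>. hermite i x * z ^ i * \<phi> x) sums transform \<phi> z"
    unfolding transform_def by (rule integral_sums_dominated(3)[OF _ sums g bound]) measurable
  moreover have "(LINT x|gauss \<sigma>. hermite i x * z ^ i * \<phi> x) = of_real (sqrt (weight i)) * coeff \<phi> i * z ^ i" for i
  proof -
    have eq: "hermite i x * z ^ i * \<phi> x = of_real (sqrt (weight i)) * z ^ i * (\<phi> x * cnj (hermite i x / of_real (sqrt (weight i))))" for x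
      using weight_pos[of i] by (simp add: hermite_def)
    show ?thesis
      by (simp only: eq coeff_def integral_mult_right_zero) (simp only: mult_ac)
  qed
  ultimately show "(\<lambda>n. of_real (sqrt (weight n)) * coeff \<phi> n * z ^ n) sums transform \<phi> z"
    by simp
qed

lemma transform_linear:
  assumes "sq_integrable (gauss \<sigma>) \<phi>" "sq_integrable (gauss \<sigma>) \<psi>"
  shows "transform (\<lambda>x. a * \<phi> x + b * \<psi> x) z = a * transform \<phi> z + b * transform \<psi> z"
proof -
  have "kernel z x * (a * \<phi> x + b * \<psi> x) = a * (kernel z x * \<phi> x) + b * (kernel z x * \<psi> x)" for x
    by (simp add: algebra_simps)
  then show ?thesis
    unfolding transform_def using transform_series(1)[OF assms(1), of z] transform_series(1)[OF assms(2), of z] by simp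
qed

lemma AE_gauss_iff: "(AE x in gauss \<sigma>. P x) \<longleftrightarrow> (AE x in (lborel :: real measure). P x)"
  using \<sigma> unfolding gauss_def by (subst AE_density) auto

text \<open>At \<open>z = i t / s\<close> the kernel is a nonzero constant times \<open>exp (i t x)\<close>, so the Fourier transform of
  the density of the Gaussian measure times \<open>\<phi>\<close> vanishes.\<close>

lemma transform_zero_imp_AE_zero:
  assumes \<phi>: "sq_integrable (gauss \<sigma>) \<phi>" and zero: "\<And>z. transform \<phi> z = 0"
  shows "AE x in lborel. \<phi> x = 0"
proof -
  have [measurable]: "\<phi> \<in> borel_measurable borel"
    using sq_integrable_measurable[OF \<phi>] by simp
  define d where "d x = sqrt (\<sigma> / pi) * exp (- \<sigma> * x\<^sup>2)" for x
  have d: "d x > 0" for x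
    using \<sigma> by (simp add: d_def)
  have [measurable]: "d \<in> borel_measurable borel"
    unfolding d_def [abs_def] by measurable
  have gauss: "gauss \<sigma> = density lborel (\<lambda>x. ennreal (d x))"
    by (simp add: gauss_def d_def)
  have kernel0: "kernel 0 x = 1" for x
    by (simp add: kernel_def)
  have int: "integrable lborel (\<lambda>x. d x *\<^sub>R \<phi> x)"
    using transform_series(1)[OF \<phi>, of 0] d unfolding gauss kernel0
    by (subst (asm) integrable_density) (auto intro: less_imp_le)
  have "AE x in lborel. d x *\<^sub>R \<phi> x = 0"
  proof (rule AE_zero_if_fourier_zero[OF int])
    fix t :: real
    define z where "z = \<i> * of_real (t / s)"
    have "of_real (s * x) * z = \<i> * of_real (t * x)" for x
      using s(2) by (simp add: z_def)
    then have "kernel z x = exp (of_real q * z\<^sup>2) * iexp (t * x)" for x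
      by (simp only: kernel_def exp_add mult.commute)
    then have "transform \<phi> z = exp (of_real q * z\<^sup>2) * (LINT x|gauss \<sigma>. iexp (t * x) * \<phi> x)"
      by (simp add: transform_def mult.assoc)
    then have "(LINT x|gauss \<sigma>. iexp (t * x) * \<phi> x) = 0"
      using zero[of z] by simp
    then show "(LINT x|lborel. iexp (t * x) * d x *\<^sub>R \<phi> x) = 0"
      unfolding gauss using d by (subst (asm) integral_density) (auto intro: less_imp_le)
  qed
  then show ?thesis
    by eventually_elim (use d in \<open>simp add: less_imp_neq[symmetric]\<close>)
qed

lemma parseval_gauss:
  assumes "sq_integrable (gauss \<sigma>) \<phi>"
  shows "(LINT x|gauss \<sigma>. (cmod (\<phi> x))\<^sup>2) = (\<Sum>n. (cmod (coeff \<phi> n))\<^sup>2)"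
proof (rule parseval[OF _ assms])
  fix g assume g: "sq_integrable (gauss \<sigma>) g" and "\<And>n. coeff g n = 0"
  then have "transform g z = 0" for z
    using transform_series(2)[OF g, of z] by (simp add: sums_iff)
  then show "AE x in gauss \<sigma>. g x = 0"
    unfolding AE_gauss_iff by (rule transform_zero_imp_AE_zero[OF g])
qed

text \<open>
  Both squared norms equal the sum of the squared coefficients of \<open>\<phi>\<close>: the one by Parseval's identity, the
  other because \<open>weight n\<close> is inverse to the squared norm of \<open>z\<^sup>n\<close>.
\<close>

lemma transform_isometry:
  assumes \<phi>: "sq_integrable (gauss \<sigma>) \<phi>"
  shows "sq_integrable (gauss (\<nu> / 2)) (transform \<phi>)"
    and "(LINT z|gauss (\<nu> / 2). (cmod (transform \<phi> z))\<^sup>2) = (LINT x|gauss \<sigma>. (cmod (\<phi> x))\<^sup>2)"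
proof -
  have "(\<integral>\<^sup>+z. ennreal ((cmod (transform \<phi> z))\<^sup>2) \<partial>gauss (\<nu> / 2))
      = (\<Sum>n. ennreal ((cmod (of_real (sqrt (weight n)) * coeff \<phi> n))\<^sup>2 * fact n / (\<nu> / 2) ^ n))"
    using \<nu> by (intro nn_integral_gauss_entire transform_series \<phi>) simp
  also have "\<dots> = (\<Sum>n. ennreal ((cmod (coeff \<phi> n))\<^sup>2))"
  proof (rule suminf_cong)
    fix n
    have "(cmod (of_real (sqrt (weight n)) * coeff \<phi> n))\<^sup>2 * fact n / (\<nu> / 2) ^ n = (cmod (coeff \<phi> n))\<^sup>2 * (weight n * (fact n / (\<nu> / 2) ^ n))"
      using weight_pos[of n] by (simp add: norm_mult power_mult_distrib)
    also have "weight n * (fact n / (\<nu> / 2) ^ n) = 1"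
      using \<nu> by (simp add: weight_def)
    finally show "ennreal ((cmod (of_real (sqrt (weight n)) * coeff \<phi> n))\<^sup>2 * fact n / (\<nu> / 2) ^ n) = ennreal ((cmod (coeff \<phi> n))\<^sup>2)"
      by simp
  qed
  also have "\<dots> = ennreal (LINT x|gauss \<sigma>. (cmod (\<phi> x))\<^sup>2)"
    unfolding parseval_gauss[OF \<phi>] by (rule suminf_ennreal2) (auto intro: summable_coeff \<phi>)
  finally have nn: "(\<integral>\<^sup>+z. ennreal ((cmod (transform \<phi> z))\<^sup>2) \<partial>gauss (\<nu> / 2)) = ennreal (LINT x|gauss \<sigma>. (cmod (\<phi> x))\<^sup>2)" .
  have "transform \<phi> \<in> borel_measurable borel"
    by (rule borel_measurable_LIMSEQ_metric[of "\<lambda>N z. \<Sum>n<N. of_real (sqrt (weight n)) * coeff \<phi> n * z ^ n"])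
       (use transform_series(2)[OF \<phi>] in \<open>auto simp: sums_def\<close>)
  then show sq: "sq_integrable (gauss (\<nu> / 2)) (transform \<phi>)"
    using nn by (intro sq_integrable_nn_integralI(1)[where C = "LINT x|gauss \<sigma>. (cmod (\<phi> x))\<^sup>2"]) auto
  show "(LINT z|gauss (\<nu> / 2). (cmod (transform \<phi> z))\<^sup>2) = (LINT x|gauss \<sigma>. (cmod (\<phi> x))\<^sup>2)"
    using nn nn_integral_eq_integral[OF sq_integrableD[OF sq]] by simp
qed

lemma transform_holomorphic:
  assumes "sq_integrable (gauss \<sigma>) \<phi>"
  shows "transform \<phi> holomorphic_on UNIV"
proof -
  have "transform \<phi> holomorphic_on ball 0 r" for r
    by (rule power_series_holomorphic[where a = "\<lambda>n. of_real (sqrt (weight n)) * coeff \<phi> n"])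
       (use transform_series(2)[OF assms] in simp)
  then have "transform \<phi> holomorphic_on (\<Union>r. ball 0 r)"
    by (intro holomorphic_on_UN_open) auto
  moreover have "(\<Union>r. ball (0::complex) r) = UNIV"
    by (auto simp: gt_ex)
  ultimately show ?thesis by simp
qed

text \<open>Finite norm of \<open>F\<close> says that its Taylor coefficients, divided by the norms of the polynomials, are square
  summable; a \<open>\<phi>\<close> with these coefficients has a transform with the Taylor series of \<open>F\<close>.\<close>

lemma transform_surj:
  assumes F: "F holomorphic_on UNIV" and sq: "sq_integrable (gauss (\<nu> / 2)) F"
  obtains \<phi> where "sq_integrable (gauss \<sigma>) \<phi>" "\<And>z. transform \<phi> z = F z"
proof -
  define a where "a n = (deriv ^^ n) F 0 / fact n" for n
  have a: "(\<lambda>n. a n * z ^ n) sums F z" for z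
    using holomorphic_power_series[of F 0 "norm z + 1" z] holomorphic_on_subset[OF F] by (simp add: a_def)
  define b where "b n = a n / of_real (sqrt (weight n))" for n
  have b2: "(cmod (b n))\<^sup>2 = (cmod (a n))\<^sup>2 * fact n / (\<nu> / 2) ^ n" for n
    using weight_pos[of n] by (simp add: b_def norm_divide power_divide weight_def)
  have "(\<Sum>n. ennreal ((cmod (b n))\<^sup>2)) = (\<integral>\<^sup>+z. ennreal ((cmod (F z))\<^sup>2) \<partial>gauss (\<nu> / 2))"
    unfolding b2 using \<nu> by (intro nn_integral_gauss_entire[OF _ a, symmetric]) simp
  also have "\<dots> \<noteq> \<top>"
    using nn_integral_eq_integral[OF sq_integrableD[OF sq]] by simp
  finally have "summable (\<lambda>n. (cmod (b n))\<^sup>2)"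
    by (intro summable_suminf_not_top) auto
  then obtain \<phi> where \<phi>: "sq_integrable (gauss \<sigma>) \<phi>" "\<And>n. coeff \<phi> n = b n"
    using riesz_fischer by blast
  have "transform \<phi> z = F z" for z
    using sums_unique2[OF transform_series(2)[OF \<phi>(1), of z]] a[of z] weight_pos by (simp add: \<phi>(2) b_def less_imp_neq[symmetric])
  then show thesis
    using that \<phi>(1) by blast
qed

end

text \<open>Polarization turns the equality of norms into the equality of inner products.\<close>

lemma polarization_sq_integrable:
  assumes f: "sq_integrable M f" and g: "sq_integrable M g"
  shows "(LINT x|M. f x * cnj (g x)) =
    (of_real (LINT x|M. (cmod (f x + g x))\<^sup>2) - of_real (LINT x|M. (cmod (f x - g x))\<^sup>2)
      + \<i> * of_real (LINT x|M. (cmod (f x + \<i> * g x))\<^sup>2) - \<i> * of_real (LINT x|M. (cmod (f x - \<i> * g x))\<^sup>2)) / 4"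
proof -
  have eq: "f x * cnj (g x) = (of_real ((cmod (f x + g x))\<^sup>2) - of_real ((cmod (f x - g x))\<^sup>2)
      + \<i> * of_real ((cmod (f x + \<i> * g x))\<^sup>2) - \<i> * of_real ((cmod (f x - \<i> * g x))\<^sup>2)) / 4" for x
    unfolding complex_norm_square by (simp add: algebra_simps)
  have "integrable M (\<lambda>x. (cmod (f x + g x))\<^sup>2)" "integrable M (\<lambda>x. (cmod (f x - g x))\<^sup>2)"
    "integrable M (\<lambda>x. (cmod (f x + \<i> * g x))\<^sup>2)" "integrable M (\<lambda>x. (cmod (f x - \<i> * g x))\<^sup>2)"
    by (intro sq_integrableD sq_integrable_add sq_integrable_diff sq_integrable_cmult f g)+
  then show ?thesis
    by (simp only: eq) (simp del: of_real_power)
qed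

context segal_bargmann
begin

lemma transform_inner:
  assumes \<phi>: "sq_integrable (gauss \<sigma>) \<phi>" and \<psi>: "sq_integrable (gauss \<sigma>) \<psi>"
  shows "(LINT z|gauss (\<nu> / 2). transform \<phi> z * cnj (transform \<psi> z)) = (LINT x|gauss \<sigma>. \<phi> x * cnj (\<psi> x))"
proof -
  have iso: "(LINT z|gauss (\<nu> / 2). (cmod (transform \<phi> z + b * transform \<psi> z))\<^sup>2) = (LINT x|gauss \<sigma>. (cmod (\<phi> x + b * \<psi> x))\<^sup>2)" for b
    using transform_isometry(2)[OF sq_integrable_add[OF \<phi> sq_integrable_cmult[OF \<psi>, of b]]] transform_linear[OF \<phi> \<psi>, of 1 b] by simp
  show ?thesis
    unfolding polarization_sq_integrable[OF transform_isometry(1)[OF \<phi>] transform_isometry(1)[OF \<psi>]]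
      polarization_sq_integrable[OF \<phi> \<psi>]
    using iso[of 1] iso[of "-1"] iso[of \<i>] iso[of "-\<i>"] by simp
qed

end

section \<open>Idempotent components\<close>

text \<open>The idempotent coordinates are ring homomorphisms onto \<^typ>\<open>complex\<close>, and together they are injective.\<close>

lemma bc_alpha_simps [simp]:
  "bc_alpha (Z + W) = bc_alpha Z + bc_alpha W" "bc_alpha (Z - W) = bc_alpha Z - bc_alpha W"
  "bc_alpha (- Z) = - bc_alpha Z" "bc_alpha (r *\<^sub>R Z) = of_real r * bc_alpha Z"
  "bc_alpha 0 = 0" "bc_alpha 1 = 1" "bc_alpha (Z * W) = bc_alpha Z * bc_alpha W"
  by (simp_all add: bc_alpha_def bicomplex_ring_defs scaleR_bicomplex_def scaleR_conv_of_real algebra_simps)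

lemma bc_alpha_of_real [simp]: "bc_alpha (of_real r) = of_real r"
  unfolding of_real_def[where 'a = bicomplex] by simp

lemma bc_beta_simps [simp]:
  "bc_beta (Z + W) = bc_beta Z + bc_beta W" "bc_beta (Z - W) = bc_beta Z - bc_beta W"
  "bc_beta (- Z) = - bc_beta Z" "bc_beta (r *\<^sub>R Z) = of_real r * bc_beta Z"
  "bc_beta 0 = 0" "bc_beta 1 = 1" "bc_beta (Z * W) = bc_beta Z * bc_beta W"
  by (simp_all add: bc_beta_def bicomplex_ring_defs scaleR_bicomplex_def scaleR_conv_of_real algebra_simps)

lemma bc_beta_of_real [simp]: "bc_beta (of_real r) = of_real r"
  unfolding of_real_def[where 'a = bicomplex] by simp

lemma bc_alpha_power [simp]: "bc_alpha (Z ^ n) = bc_alpha Z ^ n"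
  and bc_beta_power [simp]: "bc_beta (Z ^ n) = bc_beta Z ^ n"
  by (induction n) simp_all

lemma bc_alpha_star_exp [simp]:
  "bc_alpha (bc_star Z) = cnj (bc_alpha Z)" "bc_beta (bc_star Z) = cnj (bc_beta Z)"
  "bc_alpha (bc_exp Z) = exp (bc_alpha Z)" "bc_beta (bc_exp Z) = exp (bc_beta Z)"
  "bc_alpha (inverse Z) = inverse (bc_alpha Z)" "bc_beta (inverse Z) = inverse (bc_beta Z)"
  "bc_alpha (Z / W) = bc_alpha Z / bc_alpha W" "bc_beta (Z / W) = bc_beta Z / bc_beta W"
  by (simp_all add: bc_star_def bc_exp_def inverse_bicomplex_def divide_bicomplex_def divide_inverse)

lemma bicomplex_eqI: "bc_alpha Z = bc_alpha W \<Longrightarrow> bc_beta Z = bc_beta W \<Longrightarrow> Z = W"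
  by (metis bc_idem_alpha_beta)

lemma bounded_linear_bc_alpha: "bounded_linear bc_alpha"
  and bounded_linear_bc_beta: "bounded_linear bc_beta"
  by (auto intro!: linearI simp: scaleR_conv_of_real simp flip: linear_conv_bounded_linear)

lemma bounded_linear_idem: "bounded_linear (\<lambda>z. bc_idem z 0)" "bounded_linear (\<lambda>z. bc_idem 0 z)"
  by (auto intro!: linearI bicomplex_eqI simp: scaleR_conv_of_real simp flip: linear_conv_bounded_linear)

lemma bc_idem_add: "bc_idem a b = bc_idem a 0 + bc_idem 0 b"
  by (rule bicomplex_eqI) simp_all

lemma borel_measurable_bc_idem [measurable (raw)]:
  assumes "f \<in> borel_measurable M" "g \<in> borel_measurable M"
  shows "(\<lambda>x. bc_idem (f x) (g x)) \<in> borel_measurable M"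
  by (subst bc_idem_add, intro borel_measurable_add measurable_compose[OF assms(1)] measurable_compose[OF assms(2)]
      borel_measurable_continuous_onI linear_continuous_on bounded_linear_idem)

lemma borel_measurable_bc_alpha_beta [measurable]:
  "bc_alpha \<in> borel_measurable borel" "bc_beta \<in> borel_measurable borel"
  by (intro borel_measurable_continuous_onI linear_continuous_on bounded_linear_bc_alpha bounded_linear_bc_beta)+

lemma borel_measurable_bicomplex_iff:
  "f \<in> borel_measurable M \<longleftrightarrow> (\<lambda>x. bc_alpha (f x)) \<in> borel_measurable M \<and> (\<lambda>x. bc_beta (f x)) \<in> borel_measurable M"
proof
  assume "(\<lambda>x. bc_alpha (f x)) \<in> borel_measurable M \<and> (\<lambda>x. bc_beta (f x)) \<in> borel_measurable M"
  then have "(\<lambda>x. bc_idem (bc_alpha (f x)) (bc_beta (f x))) \<in> borel_measurable M"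
    by (intro borel_measurable_bc_idem) auto
  then show "f \<in> borel_measurable M" by simp
qed auto

lemma integrable_bicomplex_iff:
  "integrable M f \<longleftrightarrow> integrable M (\<lambda>x. bc_alpha (f x)) \<and> integrable M (\<lambda>x. bc_beta (f x))"
proof
  assume "integrable M (\<lambda>x. bc_alpha (f x)) \<and> integrable M (\<lambda>x. bc_beta (f x))"
  then have "integrable M (\<lambda>x. bc_idem (bc_alpha (f x)) 0 + bc_idem 0 (bc_beta (f x)))"
    by (intro Bochner_Integration.integrable_add integrable_bounded_linear[OF bounded_linear_idem(1)]
          integrable_bounded_linear[OF bounded_linear_idem(2)]) auto
  then show "integrable M f"
    by (simp flip: bc_idem_add)
qed (auto intro: integrable_bounded_linear[OF bounded_linear_bc_alpha]
       integrable_bounded_linear[OF bounded_linear_bc_beta])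

lemma bc_alpha_integral: "integrable M f \<Longrightarrow> bc_alpha (LINT x|M. f x) = (LINT x|M. bc_alpha (f x))"
  and bc_beta_integral: "integrable M f \<Longrightarrow> bc_beta (LINT x|M. f x) = (LINT x|M. bc_beta (f x))"
  by (simp_all add: integral_bounded_linear[OF bounded_linear_bc_alpha]
        integral_bounded_linear[OF bounded_linear_bc_beta])

section \<open>Bicomplex holomorphic functions\<close>

text \<open>
  This concerns one component of a bicomplex holomorphic function. Difference quotients are controlled
  only for increments \<open>(h, k)\<close> off the two axes, so the independence of \<open>b\<close> has to be obtained by a detour: the points
  \<open>(a, b)\<close> and \<open>(a, b + k)\<close> are both compared with \<open>(a + h, b + k + h)\<close>. Both differences are
  \<open>O(h)\<close>, as the quotient is taken by the first increment only; let \<open>h\<close> tend to \<open>0\<close>. So the function is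
  locally constant in \<open>b\<close>, hence constant.
\<close>

lemma holomorphic_if_derivative_off_axes:
  fixes U :: "complex \<Rightarrow> complex \<Rightarrow> complex"
  assumes U: "\<And>a b. \<exists>L. \<forall>e>0. \<exists>d>0. \<forall>h k. h \<noteq> 0 \<longrightarrow> k \<noteq> 0 \<longrightarrow> cmod h + cmod k < d \<longrightarrow>
      cmod ((U (a + h) (b + k) - U a b) / h - L) < e"
  obtains F where "F holomorphic_on UNIV" "\<And>a b. U a b = F a"
proof -
  have lip: "\<exists>C d. C > 0 \<and> d > 0 \<and> (\<forall>h k. h \<noteq> 0 \<longrightarrow> k \<noteq> 0 \<longrightarrow> cmod h + cmod k < d \<longrightarrow>
      cmod (U (a + h) (b + k) - U a b) \<le> C * cmod h)" for a b
  proof -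
    obtain L d where d: "d > 0" and L: "\<And>h k. h \<noteq> 0 \<Longrightarrow> k \<noteq> 0 \<Longrightarrow> cmod h + cmod k < d \<Longrightarrow>
        cmod ((U (a + h) (b + k) - U a b) / h - L) < 1"
      using U[of a b] zero_less_one by meson
    have "cmod (U (a + h) (b + k) - U a b) \<le> (cmod L + 1) * cmod h"
      if "h \<noteq> 0" "k \<noteq> 0" "cmod h + cmod k < d" for h k
    proof -
      have "cmod ((U (a + h) (b + k) - U a b) / h) \<le> cmod L + 1"
        using L[OF that] norm_triangle_ineq[of L "(U (a + h) (b + k) - U a b) / h - L"] by simp
      then show ?thesis
        using that(1) by (simp add: norm_divide divide_le_eq)
    qed
    then show ?thesis
      using d by (intro exI[of _ "cmod L + 1"] exI[of _ d]) (auto intro: add_nonneg_pos)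
  qed
  have local: "\<exists>d>0. \<forall>k. cmod k < d \<longrightarrow> U a (b + k) = U a b" for a b
  proof -
    obtain C d where Cd: "C > 0" "d > 0" and C: "\<And>h k. h \<noteq> 0 \<Longrightarrow> k \<noteq> 0 \<Longrightarrow> cmod h + cmod k < d \<Longrightarrow>
      cmod (U (a + h) (b + k) - U a b) \<le> C * cmod h"
      using lip[of a b] by blast
    have "U a (b + k) = U a b" if k: "cmod k < d" for k
    proof (cases "k = 0")
      case False
      obtain C' d' where Cd': "C' > 0" "d' > 0" and C': "\<And>h l. h \<noteq> 0 \<Longrightarrow> l \<noteq> 0 \<Longrightarrow> cmod h + cmod l < d' \<Longrightarrow>
          cmod (U (a + h) (b + k + l) - U a (b + k)) \<le> C' * cmod h"
        using lip[of a "b + k"] by blast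
      define r where "r = min (d' / 2) (min (cmod k) ((d - cmod k) / 2))"
      have r: "r > 0"
        using Cd' k False by (simp add: r_def)
      have "cmod (U a (b + k) - U a b) \<le> (C + C') * x" if x: "0 < x" "x < r" for x
      proof -
        define h where "h = complex_of_real x"
        have h: "h \<noteq> 0" "cmod h = x" using x by (simp_all add: h_def)
        have kh: "k + h \<noteq> 0"
          using x h by (auto simp: r_def add_eq_0_iff)
        have "cmod h + cmod (k + h) < d"
          using norm_triangle_ineq[of k h] x h by (simp add: r_def)
        then have 1: "cmod (U (a + h) (b + (k + h)) - U a b) \<le> C * x"
          using C[of h "k + h"] h kh by simp
        have 2: "cmod (U (a + h) (b + k + h) - U a (b + k)) \<le> C' * x"
          using C'[of h h] h x by (simp add: r_def)
        show ?thesis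
          using norm_triangle_ineq4[of "U (a + h) (b + k + h) - U a b" "U (a + h) (b + k + h) - U a (b + k)"] 1 2
          by (simp add: add.assoc distrib_right)
      qed
      then have ev: "\<forall>\<^sub>F x in at_right 0. cmod (U a (b + k) - U a b) \<le> (C + C') * x"
        using r by (auto simp: eventually_at_right_field)
      have "((\<lambda>x. (C + C') * x) \<longlongrightarrow> (C + C') * 0) (at_right 0)"
        by (intro tendsto_intros)
      from tendsto_lowerbound[OF this ev] show ?thesis by simp
    qed simp
    then show ?thesis using Cd by blast
  qed
  have const: "U a b = U a 0" for a b
  proof (rule connected_local_const[of UNIV b 0 "U a"])
    show "\<forall>x\<in>UNIV. \<forall>\<^sub>F c in at x. U a x = U a c"
    proof
      fix x
      obtain d where d: "d > 0" "\<And>k. cmod k < d \<Longrightarrow> U a (x + k) = U a x"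
        using local[of a x] by blast
      have "U a x = U a c" if "dist c x < d" for c
        using d(2)[of "c - x"] that by (simp add: dist_norm)
      then show "\<forall>\<^sub>F c in at x. U a x = U a c"
        using d(1) unfolding eventually_at by blast
    qed
  qed auto
  have "(\<lambda>a. U a 0) holomorphic_on UNIV"
    unfolding holomorphic_on_def
  proof (intro ballI)
    fix a
    obtain L where L: "\<And>e. e > 0 \<Longrightarrow> \<exists>d>0. \<forall>h k. h \<noteq> 0 \<longrightarrow> k \<noteq> 0 \<longrightarrow> cmod h + cmod k < d \<longrightarrow>
        cmod ((U (a + h) (0 + k) - U a 0) / h - L) < e"
      using U[of a 0] by blast
    have "((\<lambda>h. (U (a + h) 0 - U a 0) / h) \<longlongrightarrow> L) (at 0)"
      unfolding LIM_eq
    proof (intro allI impI)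
      fix e :: real assume "e > 0"
      from L[OF this] obtain d where d: "d > 0" and lt: "\<And>h k. h \<noteq> 0 \<Longrightarrow> k \<noteq> 0 \<Longrightarrow> cmod h + cmod k < d \<Longrightarrow>
          cmod ((U (a + h) (0 + k) - U a 0) / h - L) < e" by blast
      have "cmod ((U (a + h) 0 - U a 0) / h - L) < e" if "h \<noteq> 0" "cmod h < d / 2" for h
        using lt[of h h] that const[of "a + h" h] by simp
      then show "\<exists>d>0. \<forall>h. h \<noteq> 0 \<and> norm (h - 0) < d \<longrightarrow> norm ((U (a + h) 0 - U a 0) / h - L) < e"
        using d by (intro exI[of _ "d / 2"]) auto
    qed
    then show "(\<lambda>a. U a 0) field_differentiable at a within UNIV"
      by (auto simp: field_differentiable_def DERIV_def)
  qed
  then show thesis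
    using that const by blast
qed

lemma null_cone_iff: "Z \<in> null_cone \<longleftrightarrow> bc_alpha Z = 0 \<or> bc_beta Z = 0"
  unfolding null_cone_def using bc_idem_alpha_beta[of Z, symmetric] by fastforce

lemma norm_bc_idem_le: "norm (bc_idem h k) \<le> cmod h + cmod k"
proof (rule power2_le_imp_le)
  have "(norm (bc_idem h k))\<^sup>2 \<le> (cmod h)\<^sup>2 + (cmod k)\<^sup>2"
    unfolding norm_bicomplex_idem by simp
  also have "\<dots> \<le> (cmod h + cmod k)\<^sup>2"
    by (simp add: power2_sum)
  finally show "(norm (bc_idem h k))\<^sup>2 \<le> (cmod h + cmod k)\<^sup>2" .
qed simp

text \<open>For the \<open>\<beta>\<close> component the roles of the two coordinates are exchanged.\<close>

lemma bc_holomorphic_iff: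
  "bc_holomorphic f \<longleftrightarrow> (\<exists>F G. F holomorphic_on UNIV \<and> G holomorphic_on UNIV \<and>
      (\<forall>Z. f Z = bc_idem (F (bc_alpha Z)) (G (bc_beta Z))))"
proof
  assume f: "bc_holomorphic f"
  have quot: "\<exists>L. \<forall>e>0. \<exists>d>0. \<forall>h k. h \<noteq> 0 \<longrightarrow> k \<noteq> 0 \<longrightarrow> cmod h + cmod k < d \<longrightarrow>
      cmod (p ((f (bc_idem (a + h) (b + k)) - f (bc_idem a b)) / bc_idem h k) - L) < e"
    if p: "bounded_linear p" for p a b
  proof -
    obtain L where "((\<lambda>H. (f (bc_idem a b + H) - f (bc_idem a b)) / H) \<longlongrightarrow> L) (at 0 within - null_cone)"
      using f unfolding bc_holomorphic_def by blast
    from bounded_linear.tendsto[OF p this]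
    have lim: "((\<lambda>H. p ((f (bc_idem a b + H) - f (bc_idem a b)) / H)) \<longlongrightarrow> p L) (at 0 within - null_cone)" .
    show ?thesis
    proof (intro exI[of _ "p L"] allI impI)
      fix e :: real assume "e > 0"
      from tendstoD[OF lim this] obtain d where d: "d > 0" and lt: "\<And>H. H \<in> - null_cone \<Longrightarrow> H \<noteq> 0 \<Longrightarrow> dist H 0 < d \<Longrightarrow>
          dist (p ((f (bc_idem a b + H) - f (bc_idem a b)) / H)) (p L) < e"
        unfolding eventually_at by blast
      show "\<exists>d>0. \<forall>h k. h \<noteq> 0 \<longrightarrow> k \<noteq> 0 \<longrightarrow> cmod h + cmod k < d \<longrightarrow>
          cmod (p ((f (bc_idem (a + h) (b + k)) - f (bc_idem a b)) / bc_idem h k) - p L) < e"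
      proof (intro exI[of _ d] conjI allI impI d)
        fix h k assume h: "h \<noteq> 0" "k \<noteq> 0" "cmod h + cmod k < d"
        have sum: "bc_idem a b + bc_idem h k = bc_idem (a + h) (b + k)"
          by (rule bicomplex_eqI) simp_all
        have "bc_idem h k \<in> - null_cone" "bc_idem h k \<noteq> 0"
          using h by (simp_all add: null_cone_iff) (metis bc_alpha_idem bc_alpha_simps(5))
        from lt[OF this] show "cmod (p ((f (bc_idem (a + h) (b + k)) - f (bc_idem a b)) / bc_idem h k) - p L) < e"
          using le_less_trans[OF norm_bc_idem_le h(3)] by (simp add: dist_norm sum)
      qed
    qed
  qed
  obtain F where F: "F holomorphic_on UNIV" "\<And>a b. bc_alpha (f (bc_idem a b)) = F a"
    using holomorphic_if_derivative_off_axes[of "\<lambda>a b. bc_alpha (f (bc_idem a b))"]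
      quot[OF bounded_linear_bc_alpha] by (simp only: bc_alpha_star_exp bc_alpha_simps bc_alpha_idem) metis
  obtain G where G: "G holomorphic_on UNIV" "\<And>b a. bc_beta (f (bc_idem a b)) = G b"
  proof (rule holomorphic_if_derivative_off_axes[of "\<lambda>b a. bc_beta (f (bc_idem a b))"])
    fix b a
    have "\<exists>L. \<forall>e>0. \<exists>d>0. \<forall>k h. k \<noteq> 0 \<longrightarrow> h \<noteq> 0 \<longrightarrow> cmod k + cmod h < d \<longrightarrow>
      cmod ((bc_beta (f (bc_idem (a + k) (b + h))) - bc_beta (f (bc_idem a b))) / h - L) < e"
      using quot[OF bounded_linear_bc_beta, of a b] by (simp only: bc_alpha_star_exp bc_beta_simps bc_beta_idem)
    then show "\<exists>L. \<forall>e>0. \<exists>d>0. \<forall>h k. h \<noteq> 0 \<longrightarrow> k \<noteq> 0 \<longrightarrow> cmod h + cmod k < d \<longrightarrow>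
      cmod ((bc_beta (f (bc_idem (a + k) (b + h))) - bc_beta (f (bc_idem a b))) / h - L) < e"
      by (metis add.commute)
  qed blast
  have "f Z = bc_idem (F (bc_alpha Z)) (G (bc_beta Z))" for Z
    using F(2)[of "bc_alpha Z" "bc_beta Z"] G(2)[of "bc_alpha Z" "bc_beta Z"] by (intro bicomplex_eqI) auto
  then show "\<exists>F G. F holomorphic_on UNIV \<and> G holomorphic_on UNIV \<and>
      (\<forall>Z. f Z = bc_idem (F (bc_alpha Z)) (G (bc_beta Z)))"
    using F(1) G(1) by blast
next
  assume "\<exists>F G. F holomorphic_on UNIV \<and> G holomorphic_on UNIV \<and>
      (\<forall>Z. f Z = bc_idem (F (bc_alpha Z)) (G (bc_beta Z)))"
  then obtain F G where F: "F holomorphic_on UNIV" and G: "G holomorphic_on UNIV"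
    and f: "f = (\<lambda>Z. bc_idem (F (bc_alpha Z)) (G (bc_beta Z)))" by auto
  show "bc_holomorphic f"
    unfolding bc_holomorphic_def
  proof
    fix Z
    obtain F' where F': "((\<lambda>h. (F (bc_alpha Z + h) - F (bc_alpha Z)) / h) \<longlongrightarrow> F') (at 0)"
      using F by (auto simp: holomorphic_on_def field_differentiable_def DERIV_def)
    obtain G' where G': "((\<lambda>h. (G (bc_beta Z + h) - G (bc_beta Z)) / h) \<longlongrightarrow> G') (at 0)"
      using G by (auto simp: holomorphic_on_def field_differentiable_def DERIV_def)
    have "filterlim bc_alpha (at 0) (at 0 within - null_cone)" "filterlim bc_beta (at 0) (at 0 within - null_cone)"
      using bounded_linear.tendsto[OF bounded_linear_bc_alpha tendsto_ident_at[of 0 "- null_cone"]]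
        bounded_linear.tendsto[OF bounded_linear_bc_beta tendsto_ident_at[of 0 "- null_cone"]]
      by (auto simp: filterlim_at null_cone_iff eventually_at_filter)
    note lim = filterlim_compose[OF F' this(1)] filterlim_compose[OF G' this(2)]
    have "(f (Z + H) - f Z) / H = bc_idem ((F (bc_alpha Z + bc_alpha H) - F (bc_alpha Z)) / bc_alpha H) 0
        + bc_idem 0 ((G (bc_beta Z + bc_beta H) - G (bc_beta Z)) / bc_beta H)" for H
      by (rule bicomplex_eqI) (simp_all add: f)
    then have "((\<lambda>H. (f (Z + H) - f Z) / H) \<longlongrightarrow> bc_idem F' 0 + bc_idem 0 G') (at 0 within - null_cone)"
      by (simp only:) (intro tendsto_add bounded_linear.tendsto[OF bounded_linear_idem(1)]
          bounded_linear.tendsto[OF bounded_linear_idem(2)] lim)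
    then show "\<exists>L. ((\<lambda>H. (f (Z + H) - f Z) / H) \<longlongrightarrow> L) (at 0 within - null_cone)" ..
  qed
qed

section \<open>The bicomplex Segal--Bargmann transform\<close>

lemma integrable_gauss_iff:
  fixes f :: "'a::euclidean_space \<Rightarrow> 'b::{banach, second_countable_topology}"
  assumes t: "t > 0" and f: "f \<in> borel_measurable borel"
  shows "integrable (gauss t) f \<longleftrightarrow> integrable lborel (\<lambda>x. exp (- t * (norm x)\<^sup>2) *\<^sub>R f x)"
proof -
  have "integrable (gauss t) f \<longleftrightarrow>
      integrable lborel (\<lambda>x. sqrt (t / pi) ^ DIM('a) *\<^sub>R (exp (- t * (norm x)\<^sup>2) *\<^sub>R f x))"
    unfolding gauss_def using t f by (subst integrable_density) auto
  also have "\<dots> \<longleftrightarrow> integrable lborel (\<lambda>x. exp (- t * (norm x)\<^sup>2) *\<^sub>R f x)"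
    (is "integrable _ (\<lambda>x. ?c *\<^sub>R ?g x) \<longleftrightarrow> _")
  proof
    assume "integrable lborel (\<lambda>x. ?c *\<^sub>R ?g x)"
    then have "integrable lborel (\<lambda>x. inverse ?c *\<^sub>R (?c *\<^sub>R ?g x))"
      by (rule integrable_scaleR_right)
    moreover have "inverse ?c *\<^sub>R (?c *\<^sub>R y) = y" for y :: 'b
      using t by simp
    ultimately show "integrable lborel ?g"
      by (simp only:)
  qed (rule integrable_scaleR_right)
  finally show ?thesis .
qed

lemma integral_gauss:
  fixes f :: "'a::euclidean_space \<Rightarrow> 'b::{banach, second_countable_topology}"
  assumes t: "t > 0" and f: "f \<in> borel_measurable borel"
  shows "(LINT x|gauss t. f x) = sqrt (t / pi) ^ DIM('a) *\<^sub>R (LINT x|lborel. exp (- t * (norm x)\<^sup>2) *\<^sub>R f x)"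
  unfolding gauss_def using t f by (subst integral_density) (auto simp flip: scaleR_scaleR)

lemma L2_space_iff:
  assumes "\<sigma> > 0"
  shows "\<phi> \<in> L2_space \<sigma> \<longleftrightarrow>
    sq_integrable (gauss \<sigma>) (\<lambda>x. bc_alpha (\<phi> x)) \<and> sq_integrable (gauss \<sigma>) (\<lambda>x. bc_beta (\<phi> x))"
proof -
  have "sq_integrable (gauss \<sigma>) f \<longleftrightarrow> f \<in> borel_measurable lborel \<and> integrable lborel (\<lambda>x. (cmod (f x))\<^sup>2 * exp (- \<sigma> * x\<^sup>2))"
    for f :: "real \<Rightarrow> complex"
    using assms integrable_gauss_iff[OF assms, of "\<lambda>x. (cmod (f x))\<^sup>2"]
    by (auto simp: sq_integrable_def mult.commute)
  then show ?thesis
    unfolding L2_space_def by auto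
qed

lemma bicomplex_inner_integral:
  assumes "sq_integrable M (\<lambda>x. bc_alpha (f x))" "sq_integrable M (\<lambda>x. bc_beta (f x))"
    "sq_integrable M (\<lambda>x. bc_alpha (g x))" "sq_integrable M (\<lambda>x. bc_beta (g x))"
  shows "integrable M (\<lambda>x. f x * bc_star (g x))"
    and "(LINT x|M. f x * bc_star (g x)) = bc_idem (LINT x|M. bc_alpha (f x) * cnj (bc_alpha (g x)))
      (LINT x|M. bc_beta (f x) * cnj (bc_beta (g x)))"
proof -
  show int: "integrable M (\<lambda>x. f x * bc_star (g x))"
    unfolding integrable_bicomplex_iff
    by (simp add: integrable_mult_sq_integrable sq_integrable_cnj assms)
  show "(LINT x|M. f x * bc_star (g x)) = bc_idem (LINT x|M. bc_alpha (f x) * cnj (bc_alpha (g x)))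
      (LINT x|M. bc_beta (f x) * cnj (bc_beta (g x)))"
    by (rule bicomplex_eqI) (simp_all add: bc_alpha_integral[OF int] bc_beta_integral[OF int])
qed

lemma distr_gauss_alpha: "\<nu> > 0 \<Longrightarrow> distr (gauss \<nu>) borel bc_alpha = gauss (\<nu> / 2)"
  and distr_gauss_beta: "\<nu> > 0 \<Longrightarrow> distr (gauss \<nu>) borel bc_beta = gauss (\<nu> / 2)"
  using distr_gauss_bicomplex[of \<nu> "- \<i>"] distr_gauss_bicomplex[of \<nu> \<i>]
  by (simp_all add: bc_alpha_def [abs_def] bc_beta_def [abs_def])

lemma sq_integrable_distr_iff:
  assumes "p \<in> measurable M N" "F \<in> borel_measurable N"
  shows "sq_integrable (distr M N p) F \<longleftrightarrow> sq_integrable M (\<lambda>x. F (p x))"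
  using assms by (auto simp: sq_integrable_def integrable_distr_eq intro: measurable_compose)

lemma sq_integrable_alpha_beta:
  assumes \<nu>: "\<nu> > 0" and F: "F \<in> borel_measurable borel"
  shows "sq_integrable (gauss \<nu>) (\<lambda>Z. F (bc_alpha Z)) \<longleftrightarrow> sq_integrable (gauss (\<nu> / 2)) F"
    and "sq_integrable (gauss \<nu>) (\<lambda>Z. F (bc_beta Z)) \<longleftrightarrow> sq_integrable (gauss (\<nu> / 2)) F"
  using sq_integrable_distr_iff[of bc_alpha "gauss \<nu>" borel F] sq_integrable_distr_iff[of bc_beta "gauss \<nu>" borel F] F
  by (simp_all add: distr_gauss_alpha[OF \<nu>] distr_gauss_beta[OF \<nu>])

lemma integral_alpha_beta:
  fixes F :: "complex \<Rightarrow> complex"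
  assumes \<nu>: "\<nu> > 0" and F: "F \<in> borel_measurable borel"
  shows "(LINT Z|gauss \<nu>. F (bc_alpha Z)) = (LINT z|gauss (\<nu> / 2). F z)"
    and "(LINT Z|gauss \<nu>. F (bc_beta Z)) = (LINT z|gauss (\<nu> / 2). F z)"
  using integral_distr[of bc_alpha "gauss \<nu>" borel F] integral_distr[of bc_beta "gauss \<nu>" borel F] F
  by (simp_all add: distr_gauss_alpha[OF \<nu>] distr_gauss_beta[OF \<nu>])

lemma borel_measurable_entire: "F holomorphic_on UNIV \<Longrightarrow> F \<in> borel_measurable borel"
  by (intro borel_measurable_continuous_onI holomorphic_on_imp_continuous_on)

text \<open>The integrand of \<open>\<langle>f,f\<rangle>\<close> has the components \<open>|F(\<alpha>)|\<^sup>2\<close> and \<open>|G(\<beta>)|\<^sup>2\<close>, and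
  \<open>\<alpha>\<close>, \<open>\<beta>\<close> are Gaussian.\<close>

lemma bargmann_space_iff:
  assumes \<nu>: "\<nu> > 0"
  shows "f \<in> bargmann_space \<nu> \<longleftrightarrow> (\<exists>F G. F holomorphic_on UNIV \<and> G holomorphic_on UNIV \<and>
      sq_integrable (gauss (\<nu> / 2)) F \<and> sq_integrable (gauss (\<nu> / 2)) G \<and>
      (\<forall>Z. f Z = bc_idem (F (bc_alpha Z)) (G (bc_beta Z))))"
proof -
  have "f \<in> H2_space \<nu> \<longleftrightarrow> sq_integrable (gauss (\<nu> / 2)) F \<and> sq_integrable (gauss (\<nu> / 2)) G"
    if F: "F holomorphic_on UNIV" and G: "G holomorphic_on UNIV"
      and f: "\<And>Z. f Z = bc_idem (F (bc_alpha Z)) (G (bc_beta Z))" for F G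
  proof -
    have [measurable]: "F \<in> borel_measurable borel" "G \<in> borel_measurable borel"
      using F G by (auto intro: borel_measurable_entire)
    have meas: "f \<in> borel_measurable borel"
      unfolding borel_measurable_bicomplex_iff f by simp
    have meas': "(\<lambda>Z. f Z * bc_star (f Z)) \<in> borel_measurable borel"
      unfolding borel_measurable_bicomplex_iff by (simp add: f)
    have "f \<in> H2_space \<nu> \<longleftrightarrow> integrable (gauss \<nu>) (\<lambda>Z. f Z * bc_star (f Z))"
      using meas unfolding integrable_gauss_iff[OF \<nu> meas'] by (simp add: H2_space_def)
    also have "\<dots> \<longleftrightarrow> sq_integrable (gauss \<nu>) (\<lambda>Z. F (bc_alpha Z)) \<and> sq_integrable (gauss \<nu>) (\<lambda>Z. G (bc_beta Z))"
      unfolding integrable_bicomplex_iff sq_integrable_def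
      by (simp add: f complex_norm_square[symmetric] complex_of_real_integrable_eq del: of_real_power)
    finally show ?thesis
      by (simp add: sq_integrable_alpha_beta[OF \<nu>])
  qed
  then show ?thesis
    unfolding bargmann_space_def mem_Collect_eq bc_holomorphic_iff by blast
qed

context segal_bargmann
begin

text \<open>The bicomplex kernel has the exponent on the left in each component. Expanding the square
  separates \<open>exp (- \<sigma> x\<^sup>2)\<close> from the kernel in one complex variable.\<close>

lemma kernel_exponent:
  fixes a x :: complex
  shows "- (of_real \<sigma> * (x - of_real (sqrt (\<nu> / (4 * \<sigma>))) * a)\<^sup>2)
    = - of_real \<sigma> * x\<^sup>2 + (of_real s * x * a + of_real q * a\<^sup>2)"
proof -
  define c where "c = sqrt (\<nu> / (4 * \<sigma>))"
  have "\<sigma> * c\<^sup>2 = - q"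
    using \<sigma> \<nu> by (simp add: c_def q_def)
  then have c2: "of_real \<sigma> * (of_real c)\<^sup>2 = (- of_real q :: complex)"
    by (metis of_real_minus of_real_mult of_real_power)
  have "2 * \<sigma> * c = s"
  proof (rule power2_eq_imp_eq)
    show "(2 * \<sigma> * c)\<^sup>2 = s\<^sup>2"
      using \<sigma> \<nu> by (simp add: c_def s(1) power_mult_distrib) (simp add: power2_eq_square)
  qed (use \<sigma> \<nu> s(2) in \<open>auto simp: c_def\<close>)
  then have c1: "2 * of_real \<sigma> * of_real c = (of_real s :: complex)"
    by (metis of_real_mult of_real_numeral)
  have "- (of_real \<sigma> * (x - of_real c * a)\<^sup>2)
      = - of_real \<sigma> * x\<^sup>2 + (2 * of_real \<sigma> * of_real c) * x * a - (of_real \<sigma> * (of_real c)\<^sup>2) * a\<^sup>2"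
    by (simp add: power2_eq_square algebra_simps)
  then show ?thesis
    unfolding c1 c2 by (simp add: c_def)
qed

lemma sb_kernel_components:
  "bc_alpha (sb_kernel \<sigma> \<nu> Z x) = exp (- \<sigma> * (norm x)\<^sup>2) *\<^sub>R kernel (bc_alpha Z) x"
  "bc_beta (sb_kernel \<sigma> \<nu> Z x) = exp (- \<sigma> * (norm x)\<^sup>2) *\<^sub>R kernel (bc_beta Z) x"
  by (simp_all add: sb_kernel_def kernel_exponent kernel_def scaleR_conv_of_real flip: exp_add exp_of_real)

lemma sb_transform_components:
  assumes \<phi>: "\<phi> \<in> L2_space \<sigma>"
  shows "integrable lborel (\<lambda>x. sb_kernel \<sigma> \<nu> Z x * \<phi> x)"
    and "bc_alpha (sb_transform \<sigma> \<nu> \<phi> Z) = transform (\<lambda>x. bc_alpha (\<phi> x)) (bc_alpha Z)"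
    and "bc_beta (sb_transform \<sigma> \<nu> \<phi> Z) = transform (\<lambda>x. bc_beta (\<phi> x)) (bc_beta Z)"
proof -
  have sq: "sq_integrable (gauss \<sigma>) (\<lambda>x. bc_alpha (\<phi> x))" "sq_integrable (gauss \<sigma>) (\<lambda>x. bc_beta (\<phi> x))"
    using \<phi> \<sigma> by (auto simp: L2_space_iff)
  have int: "integrable lborel (\<lambda>x. exp (- \<sigma> * (norm x)\<^sup>2) *\<^sub>R (kernel z x * f x))"
    and transform: "transform f z = sqrt (\<sigma> / pi) *\<^sub>R (LINT x|lborel. exp (- \<sigma> * (norm x)\<^sup>2) *\<^sub>R (kernel z x * f x))"
    if f: "sq_integrable (gauss \<sigma>) f" for f z
  proof -
    have [measurable]: "f \<in> borel_measurable borel"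
      using sq_integrable_measurable[OF f] by simp
    have "(\<lambda>x. kernel z x * f x) \<in> borel_measurable borel"
      by measurable
    from integrable_gauss_iff[OF \<sigma> this] integral_gauss[OF \<sigma> this] transform_series(1)[OF f, of z]
    show "integrable lborel (\<lambda>x. exp (- \<sigma> * (norm x)\<^sup>2) *\<^sub>R (kernel z x * f x))"
      "transform f z = sqrt (\<sigma> / pi) *\<^sub>R (LINT x|lborel. exp (- \<sigma> * (norm x)\<^sup>2) *\<^sub>R (kernel z x * f x))"
      by (simp_all add: transform_def)
  qed
  show I: "integrable lborel (\<lambda>x. sb_kernel \<sigma> \<nu> Z x * \<phi> x)"
    unfolding integrable_bicomplex_iff bc_alpha_simps bc_beta_simps sb_kernel_components mult_scaleR_left
    using int sq by blast
  show "bc_alpha (sb_transform \<sigma> \<nu> \<phi> Z) = transform (\<lambda>x. bc_alpha (\<phi> x)) (bc_alpha Z)"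
    "bc_beta (sb_transform \<sigma> \<nu> \<phi> Z) = transform (\<lambda>x. bc_beta (\<phi> x)) (bc_beta Z)"
    unfolding sb_transform_def transform[OF sq(1)] transform[OF sq(2)] bc_alpha_simps bc_beta_simps
      bc_alpha_integral[OF I] bc_beta_integral[OF I] sb_kernel_components mult_scaleR_left
    by (simp_all add: scaleR_conv_of_real)
qed

lemma L2_space_comb:
  assumes "\<phi> \<in> L2_space \<sigma>" "\<psi> \<in> L2_space \<sigma>"
  shows "(\<lambda>x. a * \<phi> x + b * \<psi> x) \<in> L2_space \<sigma>"
  using assms by (simp add: L2_space_iff[OF \<sigma>] sq_integrable_add sq_integrable_cmult)

lemma sb_transform_linear:
  assumes \<phi>: "\<phi> \<in> L2_space \<sigma>" and \<psi>: "\<psi> \<in> L2_space \<sigma>"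
  shows "sb_transform \<sigma> \<nu> (\<lambda>x. a * \<phi> x + b * \<psi> x) =
    (\<lambda>Z. a * sb_transform \<sigma> \<nu> \<phi> Z + b * sb_transform \<sigma> \<nu> \<psi> Z)"
proof
  fix Z
  show "sb_transform \<sigma> \<nu> (\<lambda>x. a * \<phi> x + b * \<psi> x) Z = a * sb_transform \<sigma> \<nu> \<phi> Z + b * sb_transform \<sigma> \<nu> \<psi> Z"
    using \<phi>[unfolded L2_space_iff[OF \<sigma>]] \<psi>[unfolded L2_space_iff[OF \<sigma>]]
    by (intro bicomplex_eqI)
       (simp_all add: sb_transform_components[OF L2_space_comb[OF \<phi> \<psi>]]
          sb_transform_components[OF \<phi>] sb_transform_components[OF \<psi>] transform_linear)
qed

lemma sb_transform_eq_iff: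
  assumes \<phi>: "\<phi> \<in> L2_space \<sigma>" and \<psi>: "\<psi> \<in> L2_space \<sigma>"
  shows "sb_transform \<sigma> \<nu> \<phi> = sb_transform \<sigma> \<nu> \<psi> \<longleftrightarrow> (AE x in lborel. \<phi> x = \<psi> x)"
proof
  assume eq: "sb_transform \<sigma> \<nu> \<phi> = sb_transform \<sigma> \<nu> \<psi>"
  define \<eta> where "\<eta> x = 1 * \<phi> x + (-1) * \<psi> x" for x
  have \<eta>: "\<eta> \<in> L2_space \<sigma>"
    unfolding \<eta>_def [abs_def] by (rule L2_space_comb[OF \<phi> \<psi>])
  have zero: "sb_transform \<sigma> \<nu> \<eta> Z = 0" for Z
    unfolding \<eta>_def [abs_def] sb_transform_linear[OF \<phi> \<psi>] by (simp add: eq)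
  have "transform (\<lambda>x. bc_alpha (\<eta> x)) z = 0" "transform (\<lambda>x. bc_beta (\<eta> x)) z = 0" for z
    using sb_transform_components(2,3)[OF \<eta>, of "bc_idem z z"] by (simp_all add: zero)
  then have "AE x in lborel. bc_alpha (\<eta> x) = 0" "AE x in lborel. bc_beta (\<eta> x) = 0"
    using \<eta>[unfolded L2_space_iff[OF \<sigma>]] by (auto intro: transform_zero_imp_AE_zero)
  then show "AE x in lborel. \<phi> x = \<psi> x"
    by eventually_elim (auto simp: \<eta>_def intro: bicomplex_eqI)
next
  assume AE: "AE x in lborel. \<phi> x = \<psi> x"
  show "sb_transform \<sigma> \<nu> \<phi> = sb_transform \<sigma> \<nu> \<psi>"
  proof
    fix Z
    have "(LINT x|lborel. sb_kernel \<sigma> \<nu> Z x * \<phi> x) = (LINT x|lborel. sb_kernel \<sigma> \<nu> Z x * \<psi> x)"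
      using AE by (intro integral_cong_AE borel_measurable_integrable sb_transform_components \<phi> \<psi>) auto
    then show "sb_transform \<sigma> \<nu> \<phi> Z = sb_transform \<sigma> \<nu> \<psi> Z"
      by (simp add: sb_transform_def)
  qed
qed

text \<open>A preimage is assembled from preimages of the two entire components.\<close>

lemma sb_transform_image: "sb_transform \<sigma> \<nu> ` L2_space \<sigma> = bargmann_space \<nu>"
proof (intro equalityI subsetI)
  fix f assume "f \<in> sb_transform \<sigma> \<nu> ` L2_space \<sigma>"
  then obtain \<phi> where \<phi>: "\<phi> \<in> L2_space \<sigma>" and f: "f = sb_transform \<sigma> \<nu> \<phi>" by blast
  note sq = \<phi>[unfolded L2_space_iff[OF \<sigma>]]
  have "f Z = bc_idem (transform (\<lambda>x. bc_alpha (\<phi> x)) (bc_alpha Z)) (transform (\<lambda>x. bc_beta (\<phi> x)) (bc_beta Z))" for Z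
    unfolding f by (rule bicomplex_eqI) (simp_all add: sb_transform_components[OF \<phi>])
  then show "f \<in> bargmann_space \<nu>"
    unfolding bargmann_space_iff[OF \<nu>]
    using transform_holomorphic[OF conjunct1[OF sq]] transform_holomorphic[OF conjunct2[OF sq]]
      transform_isometry(1)[OF conjunct1[OF sq]] transform_isometry(1)[OF conjunct2[OF sq]] by blast
next
  fix f assume "f \<in> bargmann_space \<nu>"
  then obtain F G where FG: "F holomorphic_on UNIV" "G holomorphic_on UNIV"
    "sq_integrable (gauss (\<nu> / 2)) F" "sq_integrable (gauss (\<nu> / 2)) G"
    and f: "\<And>Z. f Z = bc_idem (F (bc_alpha Z)) (G (bc_beta Z))"
    unfolding bargmann_space_iff[OF \<nu>] by blast
  obtain \<phi> where \<phi>: "sq_integrable (gauss \<sigma>) \<phi>" "\<And>z. transform \<phi> z = F z"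
    using transform_surj[OF FG(1,3)] by blast
  obtain \<psi> where \<psi>: "sq_integrable (gauss \<sigma>) \<psi>" "\<And>z. transform \<psi> z = G z"
    using transform_surj[OF FG(2,4)] by blast
  have L2: "(\<lambda>x. bc_idem (\<phi> x) (\<psi> x)) \<in> L2_space \<sigma>"
    using \<phi>(1) \<psi>(1) by (simp add: L2_space_iff[OF \<sigma>])
  have "f = sb_transform \<sigma> \<nu> (\<lambda>x. bc_idem (\<phi> x) (\<psi> x))"
    by (rule ext, rule bicomplex_eqI) (simp_all add: f sb_transform_components[OF L2] \<phi>(2) \<psi>(2))
  then show "f \<in> sb_transform \<sigma> \<nu> ` L2_space \<sigma>"
    using L2 by blast
qed

text \<open>Each component of the inner product depends on one idempotent coordinate only, and is integrated by
  its Gaussian distribution.\<close>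

lemma sb_transform_inner:
  assumes \<phi>: "\<phi> \<in> L2_space \<sigma>" and \<psi>: "\<psi> \<in> L2_space \<sigma>"
  shows "H2_inner \<nu> (sb_transform \<sigma> \<nu> \<phi>) (sb_transform \<sigma> \<nu> \<psi>) = L2_inner \<sigma> \<phi> \<psi>"
proof -
  define a where "a \<eta> x = bc_alpha (\<eta> x)" for \<eta> :: "real \<Rightarrow> bicomplex" and x
  define b where "b \<eta> x = bc_beta (\<eta> x)" for \<eta> :: "real \<Rightarrow> bicomplex" and x
  let ?f = "sb_transform \<sigma> \<nu> \<phi>" and ?g = "sb_transform \<sigma> \<nu> \<psi>"
  have sq: "sq_integrable (gauss \<sigma>) (a \<phi>)" "sq_integrable (gauss \<sigma>) (b \<phi>)"
    "sq_integrable (gauss \<sigma>) (a \<psi>)" "sq_integrable (gauss \<sigma>) (b \<psi>)"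
    using \<phi> \<psi> unfolding L2_space_iff[OF \<sigma>] by (auto simp: a_def [abs_def] b_def [abs_def])
  note sqT = sq[THEN transform_isometry(1)]
  have [measurable]: "transform (a \<phi>) \<in> borel_measurable borel" "transform (b \<phi>) \<in> borel_measurable borel"
    "transform (a \<psi>) \<in> borel_measurable borel" "transform (b \<psi>) \<in> borel_measurable borel"
    using sqT[THEN sq_integrable_measurable] by simp_all
  have f: "bc_alpha (?f Z) = transform (a \<phi>) (bc_alpha Z)" "bc_beta (?f Z) = transform (b \<phi>) (bc_beta Z)"
    and g: "bc_alpha (?g Z) = transform (a \<psi>) (bc_alpha Z)" "bc_beta (?g Z) = transform (b \<psi>) (bc_beta Z)" for Z
    by (simp_all add: sb_transform_components[OF \<phi>] sb_transform_components[OF \<psi>] a_def [abs_def] b_def [abs_def])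
  have sqH: "sq_integrable (gauss \<nu>) (\<lambda>Z. bc_alpha (?f Z))" "sq_integrable (gauss \<nu>) (\<lambda>Z. bc_beta (?f Z))"
    "sq_integrable (gauss \<nu>) (\<lambda>Z. bc_alpha (?g Z))" "sq_integrable (gauss \<nu>) (\<lambda>Z. bc_beta (?g Z))"
    unfolding f g by (simp_all add: sq_integrable_alpha_beta[OF \<nu>] sqT)
  have mH: "(\<lambda>Z. ?f Z * bc_star (?g Z)) \<in> borel_measurable borel"
    using borel_measurable_integrable[OF bicomplex_inner_integral(1)[OF sqH]] by simp
  have mL: "(\<lambda>x. \<phi> x * bc_star (\<psi> x)) \<in> borel_measurable borel"
    using borel_measurable_integrable[OF bicomplex_inner_integral(1)[OF sq[unfolded a_def [abs_def] b_def [abs_def]]]]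
    by simp
  have "sqrt (\<nu> / pi) ^ 4 = ((sqrt (\<nu> / pi))\<^sup>2)\<^sup>2"
    by (simp flip: power_mult)
  then have "H2_inner \<nu> ?f ?g = (LINT Z|gauss \<nu>. ?f Z * bc_star (?g Z))"
    using \<nu> by (simp add: integral_gauss[OF \<nu> mH] H2_inner_def)
  also have "\<dots> = bc_idem (LINT Z|gauss \<nu>. transform (a \<phi>) (bc_alpha Z) * cnj (transform (a \<psi>) (bc_alpha Z)))
      (LINT Z|gauss \<nu>. transform (b \<phi>) (bc_beta Z) * cnj (transform (b \<psi>) (bc_beta Z)))"
    unfolding bicomplex_inner_integral(2)[OF sqH] f g ..
  also have "\<dots> = bc_idem (LINT z|gauss (\<nu> / 2). transform (a \<phi>) z * cnj (transform (a \<psi>) z))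
      (LINT z|gauss (\<nu> / 2). transform (b \<phi>) z * cnj (transform (b \<psi>) z))"
    using integral_alpha_beta(1)[OF \<nu>, of "\<lambda>z. transform (a \<phi>) z * cnj (transform (a \<psi>) z)"]
      integral_alpha_beta(2)[OF \<nu>, of "\<lambda>z. transform (b \<phi>) z * cnj (transform (b \<psi>) z)"] by simp
  also have "\<dots> = bc_idem (LINT x|gauss \<sigma>. a \<phi> x * cnj (a \<psi> x)) (LINT x|gauss \<sigma>. b \<phi> x * cnj (b \<psi> x))"
    by (simp add: transform_inner sq)
  also have "\<dots> = (LINT x|gauss \<sigma>. \<phi> x * bc_star (\<psi> x))"
    using bicomplex_inner_integral(2)[of "gauss \<sigma>" \<phi> \<psi>] sq by (simp add: a_def [abs_def] b_def [abs_def])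
  also have "\<dots> = L2_inner \<sigma> \<phi> \<psi>"
    by (simp add: integral_gauss[OF \<sigma> mL] L2_inner_def)
  finally show ?thesis .
qed

end

theorem theorem5p2:
  fixes \<sigma> \<nu> :: real
  assumes "\<sigma> > 0" and "\<nu> > 0"
  shows
    "(\<forall>\<phi>\<in>L2_space \<sigma>. \<forall>Z. integrable lborel (\<lambda>x. sb_kernel \<sigma> \<nu> Z x * \<phi> x)) \<and>
     (\<forall>\<phi>\<in>L2_space \<sigma>. \<forall>\<psi>\<in>L2_space \<sigma>.
        sb_transform \<sigma> \<nu> \<phi> = sb_transform \<sigma> \<nu> \<psi> \<longleftrightarrow> (AE x in lborel. \<phi> x = \<psi> x)) \<and>
     (\<forall>\<phi>\<in>L2_space \<sigma>. \<forall>\<psi>\<in>L2_space \<sigma>. \<forall>a b :: bicomplex.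
        sb_transform \<sigma> \<nu> (\<lambda>x. a * \<phi> x + b * \<psi> x) =
          (\<lambda>Z. a * sb_transform \<sigma> \<nu> \<phi> Z + b * sb_transform \<sigma> \<nu> \<psi> Z)) \<and>
     sb_transform \<sigma> \<nu> ` L2_space \<sigma> = bargmann_space \<nu> \<and>
     (\<forall>\<phi>\<in>L2_space \<sigma>. \<forall>\<psi>\<in>L2_space \<sigma>.
        H2_inner \<nu> (sb_transform \<sigma> \<nu> \<phi>) (sb_transform \<sigma> \<nu> \<psi>) = L2_inner \<sigma> \<phi> \<psi>) \<and>
     (\<forall>\<phi>\<in>L2_space \<sigma>. H2_norm \<nu> (sb_transform \<sigma> \<nu> \<phi>) = L2_norm \<sigma> \<phi>)"
proof -
  interpret segal_bargmann \<sigma> \<nu>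
    using assms by unfold_locales
  show ?thesis
    by (intro conjI ballI allI sb_transform_components(1) sb_transform_eq_iff sb_transform_linear
        sb_transform_image sb_transform_inner)
       (simp_all add: H2_norm_def L2_norm_def sb_transform_inner)
qed

end
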